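(* Let $G$ be a trunc. A convex subtrunc $K\subseteq G$ is a truncation kernel (the kernel of a truncation homomorphism from $G$ into a trunc) if and only if it is pointwise closed, i.e. for every subset $K_0\subseteq K^+$ and every $g\in G$, $\bigvee^\bullet K_0=g$ implies $g\in K$.
   Context: All vector lattices are real. A truncation on an archimedean vector lattice $G$ is a unary operation $g\mapsto\overline g$ on $G^+$ such that for all $g,h\in G^+$: $g\wedge\overline h\le\overline g\le g$; if $\overline g=0$ then $g=0$; if $ng=\overline{ng}$ for all positive integers $n$ then $g=0$. A trunc is an archimedean vector lattice with a truncation; a truncation homomorphism is a vector lattice homomorphism between truncs preserving truncation. $\overline G=\{\overline g:g\in G^+\}$. A convex subtrunc is an order-convex vector sublattice closed under truncation. A pointed frame is a frame $L$ with a frame homomorphism $*_L\colon L\to2=\{\bot,\top\}$; pointed frame homomorphisms commute with the points. $\mathcal O_*\mathbb R$, $\mathcal O_*\overline{\mathbb R}$ are the frames of open sets of $\mathbb R$ and $\overline{\mathbb R}=[-\infty,\infty]$ pointed by $0$; $p\colon\mathcal O_*\overline{\mathbb R}\to\mathcal O_*\mathbb R$ is $U\mapsto U\cap(-\infty,\infty)$. $\mathcal R_0L$ is the set of pointed frame homomorphisms $\mathcal O_*\mathbb R\to L$; it is a trunc, each operation $w\colon\mathbb R^n\to\mathbb R$ (addition, scalar multiplication, $\vee$, $\wedge$, truncation $x\mapsto x\wedge1$) acting by $w(f_1,\dots,f_n)(V)=\bigvee\{\bigwedge_if_i(U_i):w(U_1\times\dots\times U_n)\subseteq V\}$. Madden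 representation: every trunc $G$ is isomorphic to a subtrunc of $\mathcal R_0L$ where $q\colon M\to L$ is a dense surjective pointed frame homomorphism with $M$ compact regular, such that every $g\in G\subseteq\mathcal R_0L$ has a (unique) pointed frame homomorphism $g'\colon\mathcal O_*\overline{\mathbb R}\to M$ with $q\circ g'=g\circ p$; every element of $M$ is a join of elements $g'(0,\infty]$ and $g'[-\infty,1)$, $g\in\overline G$; and the sublocale $q_*(L)$ is the intersection of the open sublocales $g'(-\infty,\infty)\to M=\{g'(-\infty,\infty)\to x:x\in M\}$, $g\in G$. This is unique up to isomorphism, and $G$ is identified with its image in $\mathcal R_0L$. For $A\subseteq G$ and $b\in G$, $\bigvee^\bullet A=b$ ($b$ is the pointwise supremum of $A$) means $\bigvee_{a\in A}a(r,\infty)=b(r,\infty)$ in $L$ for all $r\in\mathbb R$. Known fact: this holds iff $\theta(b)$ is the supremum of $\theta(A)$ for every truncation homomorphism $\theta$ out of $G$. *)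

theory Defs
  imports "HOL-Algebra.Algebraic_Closure_Type" "HOL-Library.Extended_Real"
begin

section \<open>Truncs\<close>

text \<open>The ring multiplication and unit inherited from the record \<open>module\<close> are never used:
  the locale \<open>module\<close> only constrains the additive group and the scalar multiplication.\<close>

record 'a vlat = "(real, 'a) module" +
  vsup :: "'a \<Rightarrow> 'a \<Rightarrow> 'a" (infixl \<open>\<curlyvee>\<index>\<close> 65)
  vinf :: "'a \<Rightarrow> 'a \<Rightarrow> 'a" (infixl \<open>\<curlywedge>\<index>\<close> 70)
  vtrunc :: "'a \<Rightarrow> 'a"

definition vle :: "('a, 'b) vlat_scheme \<Rightarrow> 'a \<Rightarrow> 'a \<Rightarrow> bool" (infix \<open>\<preceq>\<index>\<close> 50) where
  "x \<preceq>\<^bsub>G\<^esub> y \<longleftrightarrow> x \<curlyvee>\<^bsub>G\<^esub> y = y"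

definition pos :: "('a, 'b) vlat_scheme \<Rightarrow> 'a set" where
  "pos G = {x \<in> carrier G. \<zero>\<^bsub>G\<^esub> \<preceq>\<^bsub>G\<^esub> x}"

locale vector_lattice = module "ring_of_type_algebra :: real ring" G
  for G :: "('a, 'b) vlat_scheme" (structure) +
  assumes sup_closed: "\<lbrakk>x \<in> carrier G; y \<in> carrier G\<rbrakk> \<Longrightarrow> x \<curlyvee> y \<in> carrier G"
    and inf_closed: "\<lbrakk>x \<in> carrier G; y \<in> carrier G\<rbrakk> \<Longrightarrow> x \<curlywedge> y \<in> carrier G"
    and sup_comm: "\<lbrakk>x \<in> carrier G; y \<in> carrier G\<rbrakk> \<Longrightarrow> x \<curlyvee> y = y \<curlyvee> x"
    and inf_comm: "\<lbrakk>x \<in> carrier G; y \<in> carrier G\<rbrakk> \<Longrightarrow> x \<curlywedge> y = y \<curlywedge> x"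
    and sup_assoc: "\<lbrakk>x \<in> carrier G; y \<in> carrier G; z \<in> carrier G\<rbrakk>
      \<Longrightarrow> (x \<curlyvee> y) \<curlyvee> z = x \<curlyvee> (y \<curlyvee> z)"
    and inf_assoc: "\<lbrakk>x \<in> carrier G; y \<in> carrier G; z \<in> carrier G\<rbrakk>
      \<Longrightarrow> (x \<curlywedge> y) \<curlywedge> z = x \<curlywedge> (y \<curlywedge> z)"
    and sup_absorb: "\<lbrakk>x \<in> carrier G; y \<in> carrier G\<rbrakk> \<Longrightarrow> x \<curlyvee> (x \<curlywedge> y) = x"
    and inf_absorb: "\<lbrakk>x \<in> carrier G; y \<in> carrier G\<rbrakk> \<Longrightarrow> x \<curlywedge> (x \<curlyvee> y) = x"
    and add_mono: "\<lbrakk>x \<in> carrier G; y \<in> carrier G; z \<in> carrier G; x \<preceq> y\<rbrakk>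
      \<Longrightarrow> x \<oplus> z \<preceq> y \<oplus> z"
    and smult_pos: "\<lbrakk>0 \<le> a; x \<in> pos G\<rbrakk> \<Longrightarrow> a \<odot> x \<in> pos G"

locale archimedean_vector_lattice = vector_lattice +
  assumes archimedean: "\<lbrakk>x \<in> pos G; y \<in> carrier G; \<And>n. 0 < n \<Longrightarrow> real n \<odot> x \<preceq> y\<rbrakk> \<Longrightarrow> x = \<zero>"

locale trunc = archimedean_vector_lattice +
  assumes vtrunc_closed: "g \<in> pos G \<Longrightarrow> vtrunc G g \<in> pos G"
    and inf_vtrunc_le: "\<lbrakk>g \<in> pos G; h \<in> pos G\<rbrakk> \<Longrightarrow> g \<curlywedge> vtrunc G h \<preceq> vtrunc G g"
    and vtrunc_le: "g \<in> pos G \<Longrightarrow> vtrunc G g \<preceq> g"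
    and vtrunc_eq_zero: "\<lbrakk>g \<in> pos G; vtrunc G g = \<zero>\<rbrakk> \<Longrightarrow> g = \<zero>"
    and vtrunc_multiples: "\<lbrakk>g \<in> pos G; \<And>n. 0 < n \<Longrightarrow> real n \<odot> g = vtrunc G (real n \<odot> g)\<rbrakk>
      \<Longrightarrow> g = \<zero>"

definition trunc_hom :: "('a, 'c) vlat_scheme \<Rightarrow> ('b, 'd) vlat_scheme \<Rightarrow> ('a \<Rightarrow> 'b) set" where
  "trunc_hom G H = {\<theta> \<in> carrier G \<rightarrow> carrier H.
     (\<forall>x\<in>carrier G. \<forall>y\<in>carrier G. \<theta> (x \<oplus>\<^bsub>G\<^esub> y) = \<theta> x \<oplus>\<^bsub>H\<^esub> \<theta> y) \<and>
     (\<forall>a. \<forall>x\<in>carrier G. \<theta> (a \<odot>\<^bsub>G\<^esub> x) = a \<odot>\<^bsub>H\<^esub> \<theta> x) \<and>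
     (\<forall>x\<in>carrier G. \<forall>y\<in>carrier G. \<theta> (x \<curlyvee>\<^bsub>G\<^esub> y) = \<theta> x \<curlyvee>\<^bsub>H\<^esub> \<theta> y) \<and>
     (\<forall>x\<in>carrier G. \<forall>y\<in>carrier G. \<theta> (x \<curlywedge>\<^bsub>G\<^esub> y) = \<theta> x \<curlywedge>\<^bsub>H\<^esub> \<theta> y) \<and>
     (\<forall>g\<in>pos G. \<theta> (vtrunc G g) = vtrunc H (\<theta> g))}"

definition convex_subtrunc :: "'a vlat \<Rightarrow> 'a set \<Rightarrow> bool" where
  "convex_subtrunc G K \<longleftrightarrow>
     submodule K (ring_of_type_algebra :: real ring) G \<and>
     (\<forall>x\<in>K. \<forall>y\<in>K. x \<curlyvee>\<^bsub>G\<^esub> y \<in> K \<and> x \<curlywedge>\<^bsub>G\<^esub> y \<in> K) \<and>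
     (\<forall>x\<in>K. \<forall>z\<in>K. \<forall>y\<in>carrier G. x \<preceq>\<^bsub>G\<^esub> y \<and> y \<preceq>\<^bsub>G\<^esub> z \<longrightarrow> y \<in> K) \<and>
     (\<forall>g\<in>K \<inter> pos G. vtrunc G g \<in> K)"

text \<open>The codomain ranges over truncs carried by a subset of the type of \<open>G\<close>. This is no
  restriction: the image of a truncation homomorphism is a trunc with at most as many elements
  as \<open>G\<close>, see \<open>truncation_kernelI\<close> below.\<close>

definition truncation_kernel :: "'a vlat \<Rightarrow> 'a set \<Rightarrow> bool" where
  "truncation_kernel G K \<longleftrightarrow>
     (\<exists>(H :: 'a vlat) \<theta>. trunc H \<and> \<theta> \<in> trunc_hom G H \<and> K = {g \<in> carrier G. \<theta> g = \<zero>\<^bsub>H\<^esub>})"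

lemma trunc_inj_transfer:
  fixes G :: "'a vlat" and H :: "'b vlat"
  assumes H: "trunc H" and h: "\<theta> \<in> trunc_hom G H" and inj: "inj_on \<theta> (carrier G)"
    and zero: "\<zero>\<^bsub>G\<^esub> \<in> carrier G" "\<theta> \<zero>\<^bsub>G\<^esub> = \<zero>\<^bsub>H\<^esub>"
    and cl: "\<And>x y. \<lbrakk>x \<in> carrier G; y \<in> carrier G\<rbrakk> \<Longrightarrow> x \<oplus>\<^bsub>G\<^esub> y \<in> carrier G"
      "\<And>a x. x \<in> carrier G \<Longrightarrow> a \<odot>\<^bsub>G\<^esub> x \<in> carrier G"
      "\<And>x y. \<lbrakk>x \<in> carrier G; y \<in> carrier G\<rbrakk> \<Longrightarrow> x \<curlyvee>\<^bsub>G\<^esub> y \<in> carrier G"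
      "\<And>x y. \<lbrakk>x \<in> carrier G; y \<in> carrier G\<rbrakk> \<Longrightarrow> x \<curlywedge>\<^bsub>G\<^esub> y \<in> carrier G"
      "\<And>x. x \<in> pos G \<Longrightarrow> vtrunc G x \<in> carrier G"
  shows "trunc G"
proof -
  interpret H: trunc H by (rule H)
  let ?R = "ring_of_type_algebra :: real ring"
  have R: "carrier ?R = UNIV" "\<And>x y. x \<oplus>\<^bsub>?R\<^esub> y = x + y" "\<And>x y. x \<otimes>\<^bsub>?R\<^esub> y = x * y" "\<one>\<^bsub>?R\<^esub> = 1"
    by (simp_all add: ring_of_type_algebra_def)
  have th: "\<And>x. x \<in> carrier G \<Longrightarrow> \<theta> x \<in> carrier H"
    "\<And>x y. \<lbrakk>x \<in> carrier G; y \<in> carrier G\<rbrakk> \<Longrightarrow> \<theta> (x \<oplus>\<^bsub>G\<^esub> y) = \<theta> x \<oplus>\<^bsub>H\<^esub> \<theta> y"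
    "\<And>a x. x \<in> carrier G \<Longrightarrow> \<theta> (a \<odot>\<^bsub>G\<^esub> x) = a \<odot>\<^bsub>H\<^esub> \<theta> x"
    "\<And>x y. \<lbrakk>x \<in> carrier G; y \<in> carrier G\<rbrakk> \<Longrightarrow> \<theta> (x \<curlyvee>\<^bsub>G\<^esub> y) = \<theta> x \<curlyvee>\<^bsub>H\<^esub> \<theta> y"
    "\<And>x y. \<lbrakk>x \<in> carrier G; y \<in> carrier G\<rbrakk> \<Longrightarrow> \<theta> (x \<curlywedge>\<^bsub>G\<^esub> y) = \<theta> x \<curlywedge>\<^bsub>H\<^esub> \<theta> y"
    "\<And>g. g \<in> pos G \<Longrightarrow> \<theta> (vtrunc G g) = vtrunc H (\<theta> g)"
    using h by (auto simp: trunc_hom_def)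
  have eq: "x = y \<longleftrightarrow> \<theta> x = \<theta> y" if "x \<in> carrier G" "y \<in> carrier G" for x y
    using inj that by (auto dest: inj_onD)
  have le: "x \<preceq>\<^bsub>G\<^esub> y \<longleftrightarrow> \<theta> x \<preceq>\<^bsub>H\<^esub> \<theta> y" if "x \<in> carrier G" "y \<in> carrier G" for x y
    using that by (simp add: vle_def eq cl th)
  have pos: "x \<in> pos G \<longleftrightarrow> x \<in> carrier G \<and> \<theta> x \<in> pos H" for x
    using zero th(1) by (auto simp: pos_def le)
  have posc: "x \<in> carrier G" if "x \<in> pos G" for x using that by (simp add: pos_def)
  have neg: "(-1) \<odot>\<^bsub>H\<^esub> x \<oplus>\<^bsub>H\<^esub> x = \<zero>\<^bsub>H\<^esub>" if x: "x \<in> carrier H" for x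
  proof -
    have sc: "a \<odot>\<^bsub>H\<^esub> x \<in> carrier H" for a using H.smult_closed[of a x] x by (simp add: R)
    have one: "1 \<odot>\<^bsub>H\<^esub> x = x" using H.smult_one[of x] x by (simp add: R)
    have "(-1) \<odot>\<^bsub>H\<^esub> x \<oplus>\<^bsub>H\<^esub> 1 \<odot>\<^bsub>H\<^esub> x = 0 \<odot>\<^bsub>H\<^esub> x"
      using H.smult_l_distr[of "-1" 1 x] x by (simp add: R)
    moreover have "0 \<odot>\<^bsub>H\<^esub> x \<oplus>\<^bsub>H\<^esub> 0 \<odot>\<^bsub>H\<^esub> x = 0 \<odot>\<^bsub>H\<^esub> x"
      using H.smult_l_distr[of 0 0 x] x by (simp add: R)
    then have "0 \<odot>\<^bsub>H\<^esub> x = \<zero>\<^bsub>H\<^esub>" using sc[of 0]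
      by (metis H.M.add.l_cancel_one)
    ultimately show ?thesis by (simp add: one)
  qed
  have ab: "abelian_group G"
  proof (rule abelian_groupI)
    fix x assume x: "x \<in> carrier G"
    show "\<exists>y\<in>carrier G. y \<oplus>\<^bsub>G\<^esub> x = \<zero>\<^bsub>G\<^esub>"
      using x by (intro bexI[of _ "(-1) \<odot>\<^bsub>G\<^esub> x"]) (simp_all add: eq zero cl th neg)
  qed (simp_all add: eq zero cl th H.M.a_ac)
  have "module ?R G"
  proof (rule moduleI)
    show "cring ?R" by (rule cring_from_type_algebra)
  qed (use H.smult_l_distr H.smult_r_distr H.smult_assoc1 H.smult_one in
       \<open>simp_all add: ab eq cl th R\<close>)
  moreover have "vector_lattice_axioms G"
  proof (unfold_locales, goal_cases)
    case (9 x y z) then show ?case using H.add_mono[of "\<theta> x" "\<theta> y" "\<theta> z"]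
      by (simp add: le cl th)
  next
    case (10 a x) then show ?case using H.smult_pos[of a "\<theta> x"] by (simp add: pos cl th)
  qed (use H.sup_comm H.inf_comm H.sup_assoc H.inf_assoc H.sup_absorb H.inf_absorb
       in \<open>simp_all add: eq cl th\<close>)
  ultimately have "vector_lattice G" by (rule vector_lattice.intro)
  moreover have "archimedean_vector_lattice_axioms G"
  proof
    fix x y assume *: "x \<in> pos G" "y \<in> carrier G" "\<And>n. 0 < n \<Longrightarrow> real n \<odot>\<^bsub>G\<^esub> x \<preceq>\<^bsub>G\<^esub> y"
    have "\<theta> x = \<zero>\<^bsub>H\<^esub>"
    proof (rule H.archimedean)
      fix n :: nat assume "0 < n"
      then show "real n \<odot>\<^bsub>H\<^esub> \<theta> x \<preceq>\<^bsub>H\<^esub> \<theta> y"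
        using *(3)[of n] *(1,2) by (simp add: le cl th posc)
    qed (use * th(1) in \<open>simp_all add: pos\<close>)
    then show "x = \<zero>\<^bsub>G\<^esub>" using * by (simp add: eq posc zero)
  qed
  ultimately have "archimedean_vector_lattice G" by (rule archimedean_vector_lattice.intro)
  moreover have "trunc_axioms G"
  proof (unfold_locales, goal_cases)
    case (1 g) then show ?case using H.vtrunc_closed[of "\<theta> g"] cl(5)[of g] th(6)[of g] by (simp add: pos)
  next
    case (2 g h) then show ?case using H.inf_vtrunc_le[of "\<theta> g" "\<theta> h"]
      by (simp add: le cl th posc) (simp add: pos)
  next
    case (3 g) then show ?case using H.vtrunc_le[of "\<theta> g"]
      by (simp add: le cl th posc) (simp add: pos)
  next
    case (4 g)
    then have "\<theta> g = \<zero>\<^bsub>H\<^esub>" using H.vtrunc_eq_zero[of "\<theta> g"] th(6)[of g] zero by (simp add: pos)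
    then show ?case using 4 by (simp add: eq posc zero)
  next
    case (5 g)
    have *: "\<theta> g \<in> pos H" "g \<in> carrier G" using 5 by (simp_all add: pos)
    have "\<theta> g = \<zero>\<^bsub>H\<^esub>"
    proof (rule H.vtrunc_multiples[OF *(1)])
      fix n :: nat assume n: "0 < n"
      have "real n \<odot>\<^bsub>G\<^esub> g \<in> pos G"
        using * H.smult_pos[of "real n" "\<theta> g"] by (simp add: pos cl th)
      then show "real n \<odot>\<^bsub>H\<^esub> \<theta> g = vtrunc H (real n \<odot>\<^bsub>H\<^esub> \<theta> g)"
        using 5(2)[OF n] * th(3)[of g "real n"] th(6)[of "real n \<odot>\<^bsub>G\<^esub> g"] by simp
    qed
    then show ?case using * by (simp add: eq zero)
  qed
  ultimately show ?thesis by (rule trunc.intro)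
qed

lemma truncation_kernelI:
  fixes G :: "'g vlat" and H :: "'h vlat"
  assumes G: "trunc G" and H: "trunc H" and h: "\<theta> \<in> trunc_hom G H"
  shows "truncation_kernel G {g \<in> carrier G. \<theta> g = \<zero>\<^bsub>H\<^esub>}"
proof -
  interpret G: trunc G by (rule G)
  interpret H: trunc H by (rule H)
  let ?R = "ring_of_type_algebra :: real ring"
  have R: "carrier ?R = UNIV" by (simp add: ring_of_type_algebra_def)
  have th: "\<And>x. x \<in> carrier G \<Longrightarrow> \<theta> x \<in> carrier H"
    "\<And>x y. \<lbrakk>x \<in> carrier G; y \<in> carrier G\<rbrakk> \<Longrightarrow> \<theta> (x \<oplus>\<^bsub>G\<^esub> y) = \<theta> x \<oplus>\<^bsub>H\<^esub> \<theta> y"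
    "\<And>a x. x \<in> carrier G \<Longrightarrow> \<theta> (a \<odot>\<^bsub>G\<^esub> x) = a \<odot>\<^bsub>H\<^esub> \<theta> x"
    "\<And>x y. \<lbrakk>x \<in> carrier G; y \<in> carrier G\<rbrakk> \<Longrightarrow> \<theta> (x \<curlyvee>\<^bsub>G\<^esub> y) = \<theta> x \<curlyvee>\<^bsub>H\<^esub> \<theta> y"
    "\<And>x y. \<lbrakk>x \<in> carrier G; y \<in> carrier G\<rbrakk> \<Longrightarrow> \<theta> (x \<curlywedge>\<^bsub>G\<^esub> y) = \<theta> x \<curlywedge>\<^bsub>H\<^esub> \<theta> y"
    "\<And>g. g \<in> pos G \<Longrightarrow> \<theta> (vtrunc G g) = vtrunc H (\<theta> g)"
    using h by (auto simp: trunc_hom_def)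
  define I where "I = \<theta> ` carrier G"
  define s where "s = inv_into (carrier G) \<theta>"
  have s: "i \<in> I \<Longrightarrow> \<theta> (s i) = i" "i \<in> I \<Longrightarrow> s i \<in> carrier G" for i
    by (simp_all add: I_def s_def f_inv_into_f inv_into_into)
  have thI: "x \<in> carrier G \<Longrightarrow> \<theta> x \<in> I" for x by (simp add: I_def)
  have IE: "\<exists>x. x \<in> carrier G \<and> i = \<theta> x" if "i \<in> I" for i using that by (auto simp: I_def)
  have zero: "\<theta> \<zero>\<^bsub>G\<^esub> = \<zero>\<^bsub>H\<^esub>"
    using th(2)[of "\<zero>\<^bsub>G\<^esub>" "\<zero>\<^bsub>G\<^esub>"] th(1)[of "\<zero>\<^bsub>G\<^esub>"] by (metis G.M.l_zero G.M.zero_closed H.M.add.l_cancel_one)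
  have clI: "\<zero>\<^bsub>H\<^esub> \<in> I"
    "\<And>i j. i \<in> I \<Longrightarrow> j \<in> I \<Longrightarrow> i \<oplus>\<^bsub>H\<^esub> j \<in> I"
    "\<And>a i. i \<in> I \<Longrightarrow> a \<odot>\<^bsub>H\<^esub> i \<in> I"
    "\<And>i j. i \<in> I \<Longrightarrow> j \<in> I \<Longrightarrow> i \<curlyvee>\<^bsub>H\<^esub> j \<in> I"
    "\<And>i j. i \<in> I \<Longrightarrow> j \<in> I \<Longrightarrow> i \<curlywedge>\<^bsub>H\<^esub> j \<in> I"
    using zero thI[of "\<zero>\<^bsub>G\<^esub>"] G.sup_closed G.inf_closed G.smult_closed
    by (auto simp: R I_def th(2-5)[symmetric] intro!: imageI)
  have clT: "vtrunc H i \<in> I" if i: "i \<in> I" "i \<in> pos H" for i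
  proof -
    obtain x where x: "x \<in> carrier G" "i = \<theta> x" using IE i by blast
    let ?y = "\<zero>\<^bsub>G\<^esub> \<curlyvee>\<^bsub>G\<^esub> x"
    have y: "?y \<in> carrier G" using x G.sup_closed by simp
    have id: "\<zero>\<^bsub>G\<^esub> \<curlyvee>\<^bsub>G\<^esub> \<zero>\<^bsub>G\<^esub> = \<zero>\<^bsub>G\<^esub>"
      using G.sup_absorb[of "\<zero>\<^bsub>G\<^esub>" "\<zero>\<^bsub>G\<^esub> \<curlyvee>\<^bsub>G\<^esub> \<zero>\<^bsub>G\<^esub>"] G.inf_absorb[of "\<zero>\<^bsub>G\<^esub>" "\<zero>\<^bsub>G\<^esub>"] G.sup_closed by simp
    have "?y \<in> pos G"
      using y x G.sup_assoc[of "\<zero>\<^bsub>G\<^esub>" "\<zero>\<^bsub>G\<^esub>" x] id by (simp add: pos_def vle_def)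
    moreover have "\<theta> ?y = i" using x i by (simp add: th zero pos_def vle_def)
    ultimately have "vtrunc H i = \<theta> (vtrunc G ?y)" by (simp add: th)
    with G.vtrunc_closed[OF \<open>?y \<in> pos G\<close>] show ?thesis by (simp add: I_def pos_def)
  qed
  define H' :: "'g vlat" where "H' = \<lparr> carrier = s ` I, monoid.mult = undefined, one = undefined,
     ring.zero = s \<zero>\<^bsub>H\<^esub>, add = (\<lambda>x y. s (\<theta> x \<oplus>\<^bsub>H\<^esub> \<theta> y)), module.smult = (\<lambda>a x. s (a \<odot>\<^bsub>H\<^esub> \<theta> x)),
     vsup = (\<lambda>x y. s (\<theta> x \<curlyvee>\<^bsub>H\<^esub> \<theta> y)), vinf = (\<lambda>x y. s (\<theta> x \<curlywedge>\<^bsub>H\<^esub> \<theta> y)),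
     vtrunc = (\<lambda>x. s (vtrunc H (\<theta> x))) \<rparr>"
  have IH: "I \<subseteq> carrier H" using th(1) by (auto simp: I_def)
  have sinj: "i \<in> I \<Longrightarrow> j \<in> I \<Longrightarrow> s i = s j \<longleftrightarrow> i = j" for i j using s(1) by metis
  have posH': "x \<in> pos H' \<longleftrightarrow> (\<exists>i\<in>I. x = s i \<and> i \<in> pos H)" for x
    using IH by (auto simp: pos_def vle_def H'_def s clI sinj)
  have "\<theta> \<in> trunc_hom H' H"
    using IH by (auto simp: trunc_hom_def posH' s clI clT) (auto simp: H'_def s clI clT)
  moreover have "inj_on \<theta> (carrier H')" by (auto simp: H'_def inj_on_def s)
  ultimately have "trunc H'"
    by (rule trunc_inj_transfer[OF H]) (auto simp: posH', auto simp: H'_def s clI clT)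
  moreover have "s \<circ> \<theta> \<in> trunc_hom G H'"
  proof -
    have "\<theta> g \<in> pos H" if "g \<in> pos G" for g
      using that th(1)[of g] th(4)[of "\<zero>\<^bsub>G\<^esub>" g] zero by (simp add: pos_def vle_def)
    then show ?thesis
      using thI by (auto simp: trunc_hom_def H'_def s th pos_def)
  qed
  moreover have "{g \<in> carrier G. \<theta> g = \<zero>\<^bsub>H\<^esub>} = {g \<in> carrier G. (s \<circ> \<theta>) g = \<zero>\<^bsub>H'\<^esub>}"
    by (auto simp: H'_def sinj thI clI)
  ultimately show ?thesis unfolding truncation_kernel_def by blast
qed


section \<open>Pointed frames\<close>

hide_const (open) Order.top

class frame = complete_lattice +
  assumes inf_Sup_frame: "inf a (Sup B) = (SUP b\<in>B. inf a b)"

instance bool :: frame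
  by standard auto

definition frame_hom :: "('l::frame \<Rightarrow> 'm::frame) \<Rightarrow> bool" where
  "frame_hom f \<longleftrightarrow> f top = top \<and> (\<forall>x y. f (inf x y) = inf (f x) (f y)) \<and> (\<forall>S. f (Sup S) = Sup (f ` S))"

text \<open>A pointed frame is a type of class \<open>frame\<close> together with a frame homomorphism to the
  two-element frame \<open>bool\<close>.\<close>

definition pointed_frame_hom ::
    "('l::frame \<Rightarrow> bool) \<Rightarrow> ('m::frame \<Rightarrow> bool) \<Rightarrow> ('l \<Rightarrow> 'm) \<Rightarrow> bool" where
  "pointed_frame_hom pL pM f \<longleftrightarrow> frame_hom f \<and> pM \<circ> f = pL"

definition compact_frame :: "'l::frame itself \<Rightarrow> bool" where
  "compact_frame _ \<longleftrightarrow> (\<forall>S :: 'l set. Sup S = top \<longrightarrow> (\<exists>F\<subseteq>S. finite F \<and> Sup F = top))"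

definition rather_below :: "'l::frame \<Rightarrow> 'l \<Rightarrow> bool" where
  "rather_below a b \<longleftrightarrow> (\<exists>c. inf a c = bot \<and> sup b c = top)"

definition regular_frame :: "'l::frame itself \<Rightarrow> bool" where
  "regular_frame _ \<longleftrightarrow> (\<forall>x :: 'l. x = Sup {y. rather_below y x})"

definition dense_hom :: "('m::frame \<Rightarrow> 'l::frame) \<Rightarrow> bool" where
  "dense_hom q \<longleftrightarrow> (\<forall>x. q x = bot \<longrightarrow> x = bot)"

definition right_adjoint :: "('m::frame \<Rightarrow> 'l::frame) \<Rightarrow> 'l \<Rightarrow> 'm" where
  "right_adjoint q y = Sup {x. q x \<le> y}"

definition heyting_imp :: "'m::frame \<Rightarrow> 'm \<Rightarrow> 'm" where
  "heyting_imp a b = Sup {c. inf c a \<le> b}"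

definition open_sublocale :: "'m::frame \<Rightarrow> 'm set" where
  "open_sublocale a = range (heyting_imp a)"

section \<open>Frames of open sets\<close>

typedef (overloaded) 'a opens = "{U :: 'a::topological_space set. open U}"
  morphisms set_of_opens Opens
  by (rule exI[of _ "{}"]) simp

setup_lifting type_definition_opens

instantiation opens :: (topological_space) complete_lattice
begin

lift_definition less_eq_opens :: "'a opens \<Rightarrow> 'a opens \<Rightarrow> bool" is "(\<subseteq>)" .
lift_definition less_opens :: "'a opens \<Rightarrow> 'a opens \<Rightarrow> bool" is "(\<subset>)" .
lift_definition inf_opens :: "'a opens \<Rightarrow> 'a opens \<Rightarrow> 'a opens" is "(\<inter>)" by (rule open_Int)
lift_definition sup_opens :: "'a opens \<Rightarrow> 'a opens \<Rightarrow> 'a opens" is "(\<union>)" by (rule open_Un)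
lift_definition top_opens :: "'a opens" is UNIV by simp
lift_definition bot_opens :: "'a opens" is "{}" by simp
lift_definition Sup_opens :: "'a opens set \<Rightarrow> 'a opens" is Union by (rule open_Union) blast
lift_definition Inf_opens :: "'a opens set \<Rightarrow> 'a opens"
  is "\<lambda>A. \<Union>{U. open U \<and> U \<subseteq> \<Inter>A}" by (rule open_Union) blast

instance
  by standard (transfer; force)+

end

instance opens :: (topological_space) frame
  by standard (transfer; blast)

definition opens_point :: "'a::topological_space \<Rightarrow> 'a opens \<Rightarrow> bool" where
  "opens_point x U \<longleftrightarrow> x \<in> set_of_opens U"

text \<open>The map \<open>p\<close> from the opens of the extended line to those of the real line.\<close>

lift_definition restrict_real :: "ereal opens \<Rightarrow> real opens" is "\<lambda>U. ereal -` U"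
  by (rule open_vimage) (auto intro: continuous_intros)

section \<open>The trunc of pointed frame homomorphisms on the real line\<close>

text \<open>An operation \<open>w\<close> on the reals acts on frame homomorphisms, here for arities 0, 1 and 2.\<close>

definition lift0 :: "real \<Rightarrow> real opens \<Rightarrow> 'l::frame" where
  "lift0 w V = Sup {u. u = top \<and> w \<in> set_of_opens V}"

definition lift1 :: "(real \<Rightarrow> real) \<Rightarrow> (real opens \<Rightarrow> 'l::frame) \<Rightarrow> real opens \<Rightarrow> 'l" where
  "lift1 w f V = Sup {f U | U. w ` set_of_opens U \<subseteq> set_of_opens V}"

definition lift2 :: "(real \<Rightarrow> real \<Rightarrow> real) \<Rightarrow> (real opens \<Rightarrow> 'l::frame) \<Rightarrow> (real opens \<Rightarrow> 'l)
    \<Rightarrow> real opens \<Rightarrow> 'l" where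
  "lift2 w f g V = Sup {inf (f U1) (g U2) | U1 U2.
     case_prod w ` (set_of_opens U1 \<times> set_of_opens U2) \<subseteq> set_of_opens V}"

definition R0 :: "('l::frame \<Rightarrow> bool) \<Rightarrow> (real opens \<Rightarrow> 'l) vlat" where
  "R0 pL = \<lparr> carrier = {f. pointed_frame_hom (opens_point 0) pL f},
     monoid.mult = undefined, one = undefined,
     ring.zero = lift0 0, add = lift2 (+), module.smult = (\<lambda>a. lift1 (\<lambda>x. a * x)),
     vsup = lift2 max, vinf = lift2 min, vtrunc = lift1 (\<lambda>x. min x 1) \<rparr>"

section \<open>Madden representation and pointwise suprema\<close>

text \<open>Here \<open>\<rho>\<close> is the identification of \<open>G\<close> with a subtrunc of \<open>R0 pL\<close>, and \<open>ext g\<close> is the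
  extension of \<open>\<rho> g\<close> to the extended real line, which is unique since \<open>q\<close> is dense and the frame
  of opens of the extended line is regular.\<close>

locale madden_representation = trunc G
  for G :: "'g vlat" (structure) +
  fixes pL :: "'l::frame \<Rightarrow> bool" and pM :: "'m::frame \<Rightarrow> bool"
    and q :: "'m \<Rightarrow> 'l"
    and \<rho> :: "'g \<Rightarrow> real opens \<Rightarrow> 'l"
    and ext :: "'g \<Rightarrow> ereal opens \<Rightarrow> 'm"
  assumes point_L: "frame_hom pL"
    and point_M: "frame_hom pM"
    and compact_M: "compact_frame TYPE('m)"
    and regular_M: "regular_frame TYPE('m)"
    and q_hom: "pointed_frame_hom pM pL q"
    and q_dense: "dense_hom q"
    and q_surj: "surj q"
    and rho_hom: "\<rho> \<in> trunc_hom G (R0 pL)"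
    and rho_inj: "inj_on \<rho> (carrier G)"
    and ext_hom: "g \<in> carrier G \<Longrightarrow> pointed_frame_hom (opens_point 0) pM (ext g)"
    and ext_commutes: "g \<in> carrier G \<Longrightarrow> q \<circ> ext g = \<rho> g \<circ> restrict_real"
    and joins_M: "\<exists>S \<subseteq> (\<lambda>g. ext g (Opens {0<..})) ` vtrunc G ` pos G
                        \<union> (\<lambda>g. ext g (Opens {..<1})) ` vtrunc G ` pos G. x = Sup S"
    and image_L: "range (right_adjoint q)
                    = (\<Inter>g\<in>carrier G. open_sublocale (ext g (Opens {-\<infinity><..<\<infinity>})))"

definition pointwise_sup :: "('g \<Rightarrow> real opens \<Rightarrow> 'l::frame) \<Rightarrow> 'g set \<Rightarrow> 'g \<Rightarrow> bool" where
  "pointwise_sup \<rho> A b \<longleftrightarrow> (\<forall>r. (SUP a\<in>A. \<rho> a (Opens {r<..})) = \<rho> b (Opens {r<..}))"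

definition pointwise_closed ::
    "'g vlat \<Rightarrow> ('g \<Rightarrow> real opens \<Rightarrow> 'l::frame) \<Rightarrow> 'g set \<Rightarrow> bool" where
  "pointwise_closed G \<rho> K \<longleftrightarrow>
     (\<forall>K0 \<subseteq> K \<inter> pos G. \<forall>g\<in>carrier G. pointwise_sup \<rho> K0 g \<longrightarrow> g \<in> K)"

end

theory Submission
  imports Defs
begin

text \<open>
  Both conditions on \<open>K\<close> are equivalent to \<open>G / K\<close> being a trunc. The statements about \<open>\<rho>\<close> are
  reduced to real arithmetic through pseudo-points, which are arbitrary functions \<open>\<phi>\<close> from \<open>G\<close> to
  the reals: an element of \<open>L\<close> is covered by a property of pseudo-points if it lies below a join of
  finite meets of elements \<open>\<rho> i U\<close>, each of which forces the property through the constraints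
  \<open>\<phi> i \<in> U\<close>. No element except \<open>\<bottom>\<close> is covered by an unsatisfiable property, and lattice and
  truncation terms are computed pointwise on pseudo-points.

  If \<open>K\<close> is pointwise closed, the trunc axioms for \<open>G / K\<close> follow because \<open>x\<close> is the pointwise
  supremum of \<open>(x - y / n)\<^sup>+\<close>, of \<open>x \<and> n (x \<and> 1)\<close> and of \<open>(x - 1 / n)\<^sup>+\<close>. If \<open>G / K\<close> is a
  trunc, let \<open>u\<close> be the join in \<open>M\<close> of the cozero elements of \<open>K\<^sup>+\<close>. By compactness of \<open>M\<close>, a positive
  element of \<open>G\<close> belongs to \<open>K\<close> once its cozero element lies below \<open>u\<close>. By the archimedean property of
  \<open>G / K\<close>, \<open>u\<close> belongs to every open sublocale \<open>h' (-\<infinity>, \<infinity>) \<rightarrow> M\<close>, hence to the sublocale \<open>L\<close> of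
  \<open>M\<close>. So an inequality with \<open>u\<close> on the right can be tested in \<open>L\<close>, where a pointwise supremum
  is a join.
\<close>

section \<open>Frames\<close>

lemma frame_inf_sup_distrib:
  fixes a b c :: "'l::frame"
  shows "inf a (sup b c) = sup (inf a b) (inf a c)"
  using inf_Sup_frame[of a "{b, c}"] by simp

lemma frame_le_of_disjoint:
  \<comment> \<open>By distributivity \<open>a = sup (inf a b) (inf a c) = inf a c\<close>. This
    reduces inequalities in \<open>L\<close> and \<open>M\<close> to a disjointness, which
    pseudo-points can certify, together with an open cover of the line.\<close>
  fixes a b c :: "'l::frame"
  assumes "inf a b = bot" and "sup b c = top"
  shows "a \<le> c"
  using frame_inf_sup_distrib[of a b c] assms by (simp add: le_iff_inf)

lemma frame_hom_inf: "frame_hom f \<Longrightarrow> f (inf x y) = inf (f x) (f y)"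
  and frame_hom_Sup: "frame_hom f \<Longrightarrow> f (Sup S) = Sup (f ` S)"
  and frame_hom_top: "frame_hom f \<Longrightarrow> f top = top"
  by (simp_all add: frame_hom_def)

lemma frame_hom_bot: "frame_hom f \<Longrightarrow> f bot = bot"
  using frame_hom_Sup[of f "{}"] by simp

lemma frame_hom_sup: "frame_hom f \<Longrightarrow> f (sup x y) = sup (f x) (f y)"
  using frame_hom_Sup[of f "{x, y}"] by simp

lemma frame_hom_mono: "frame_hom f \<Longrightarrow> x \<le> y \<Longrightarrow> f x \<le> f y"
  by (metis frame_hom_inf le_iff_inf)

lemma frame_hom_Inf_finite:
  assumes "frame_hom f" "finite S"
  shows "f (Inf S) = Inf (f ` S)"
  using assms(2) by induction (simp_all add: frame_hom_inf[OF assms(1)] frame_hom_top[OF assms(1)])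

lemma set_of_opens_Opens [simp]: "open U \<Longrightarrow> set_of_opens (Opens U) = U"
  by (simp add: Opens_inverse)

lemma open_set_of_opens [simp]: "open (set_of_opens U)"
  using set_of_opens by blast

lemma set_of_opens_inf [simp]: "set_of_opens (inf U V) = set_of_opens U \<inter> set_of_opens V"
  by transfer simp

lemma set_of_opens_sup [simp]: "set_of_opens (sup U V) = set_of_opens U \<union> set_of_opens V"
  by transfer simp

lemma set_of_opens_Sup [simp]: "set_of_opens (Sup A) = \<Union>(set_of_opens ` A)"
  by transfer simp

lemma set_of_opens_top [simp]: "set_of_opens top = UNIV"
  by transfer simp

lemma set_of_opens_bot [simp]: "set_of_opens bot = {}"
  by transfer simp

lemma opens_eq_iff: "U = V \<longleftrightarrow> set_of_opens U = set_of_opens V"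
  by (simp add: set_of_opens_inject)

lemma set_of_opens_restrict_real [simp]: "set_of_opens (restrict_real U) = ereal -` set_of_opens U"
  by transfer simp

lemma set_of_opens_Inf_finite: "finite S \<Longrightarrow> set_of_opens (Inf S) = \<Inter>(set_of_opens ` S)"
  by (induction S rule: finite_induct) simp_all

section \<open>Evaluation at pseudo-points\<close>

context madden_representation
begin

definition cyl :: "('g \<times> real opens) set \<Rightarrow> 'l" where
  "cyl P = (INF (i, U)\<in>P. \<rho> i U)"

definition sat :: "('g \<Rightarrow> real) \<Rightarrow> ('g \<times> real opens) set \<Rightarrow> bool" where
  "sat \<phi> P \<longleftrightarrow> (\<forall>(i, U)\<in>P. \<phi> i \<in> set_of_opens U)"

definition covered :: "'l \<Rightarrow> (('g \<Rightarrow> real) \<Rightarrow> bool) \<Rightarrow> bool" where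
  "covered a A \<longleftrightarrow> a \<le> Sup {cyl P | P. finite P \<and> P \<subseteq> carrier G \<times> UNIV \<and> (\<forall>\<phi>. sat \<phi> P \<longrightarrow> A \<phi>)}"

text \<open>Only an upper bound for \<open>\<rho> x V\<close> is recorded. It passes through
  \<open>lift1\<close> and \<open>lift2\<close> because these are joins; lower bounds are recovered
  from open sets that cover the line together with \<open>V\<close>.\<close>

definition evaluates :: "'g \<Rightarrow> (('g \<Rightarrow> real) \<Rightarrow> real) \<Rightarrow> bool" where
  "evaluates x w \<longleftrightarrow> x \<in> carrier G \<and> (\<forall>V. covered (\<rho> x V) (\<lambda>\<phi>. w \<phi> \<in> set_of_opens V))"

lemma rho_pointed: "x \<in> carrier G \<Longrightarrow> pointed_frame_hom (opens_point 0) pL (\<rho> x)"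
  using rho_hom by (auto simp: trunc_hom_def R0_def)

lemma rho_frame_hom: "x \<in> carrier G \<Longrightarrow> frame_hom (\<rho> x)"
  using rho_pointed by (simp add: pointed_frame_hom_def)

lemma rho_smult: "x \<in> carrier G \<Longrightarrow> \<rho> (a \<odot> x) = lift1 (\<lambda>t. a * t) (\<rho> x)"
  using rho_hom by (simp add: trunc_hom_def R0_def)

lemma rho_ops:
  assumes "x \<in> carrier G" "y \<in> carrier G"
  shows "\<rho> (x \<oplus> y) = lift2 (+) (\<rho> x) (\<rho> y)"
    "\<rho> (x \<curlyvee> y) = lift2 max (\<rho> x) (\<rho> y)" "\<rho> (x \<curlywedge> y) = lift2 min (\<rho> x) (\<rho> y)"
  using rho_hom assms by (simp_all add: trunc_hom_def R0_def)

lemma rho_vtrunc: "x \<in> pos G \<Longrightarrow> \<rho> (vtrunc G x) = lift1 (\<lambda>t. min t 1) (\<rho> x)"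
  using rho_hom by (simp add: trunc_hom_def R0_def)

lemma scal_closed: "x \<in> carrier G \<Longrightarrow> a \<odot> x \<in> carrier G"
  using smult_closed[of a x] by (simp add: ring_of_type_algebra_def)

section \<open>Calculus of covered elements\<close>

lemma covered_mono:
  assumes "covered a A" "b \<le> a" "\<And>\<phi>. A \<phi> \<Longrightarrow> B \<phi>"
  shows "covered b B"
proof -
  have "Sup {cyl P | P. finite P \<and> P \<subseteq> carrier G \<times> UNIV \<and> (\<forall>\<phi>. sat \<phi> P \<longrightarrow> A \<phi>)}
      \<le> Sup {cyl P | P. finite P \<and> P \<subseteq> carrier G \<times> UNIV \<and> (\<forall>\<phi>. sat \<phi> P \<longrightarrow> B \<phi>)}"
    using assms(3) by (intro Sup_subset_mono) blast
  with assms(1,2) show ?thesis unfolding covered_def by (meson order_trans)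
qed

lemma covered_Sup: "(\<And>a. a \<in> S \<Longrightarrow> covered a A) \<Longrightarrow> covered (Sup S) A"
  unfolding covered_def by (auto intro: Sup_least)

lemma covered_sup:
  assumes "covered a A" "covered b B"
  shows "covered (sup a b) (\<lambda>\<phi>. A \<phi> \<or> B \<phi>)"
proof -
  have "covered a (\<lambda>\<phi>. A \<phi> \<or> B \<phi>)" "covered b (\<lambda>\<phi>. A \<phi> \<or> B \<phi>)"
    by (rule covered_mono[OF assms(1)]; simp) (rule covered_mono[OF assms(2)]; simp)
  then show ?thesis by (simp add: covered_def)
qed

text \<open>Frame distributivity, applied twice, turns the meet of joins into a join of meets. A
  meet of two cylinders is the cylinder of the union of their constraint systems, which is again
  finite.\<close>

lemma covered_inf:
  assumes "covered a A" "covered b B"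
  shows "covered (inf a b) (\<lambda>\<phi>. A \<phi> \<and> B \<phi>)"
proof -
  define F where "F A = {P. finite P \<and> P \<subseteq> carrier G \<times> UNIV \<and> (\<forall>\<phi>. sat \<phi> P \<longrightarrow> A \<phi>)}" for A
  have cov: "covered c C \<longleftrightarrow> c \<le> Sup (cyl ` F C)" for c C
  proof -
    have "{cyl P |P. finite P \<and> P \<subseteq> carrier G \<times> UNIV \<and> (\<forall>\<phi>. sat \<phi> P \<longrightarrow> C \<phi>)} = cyl ` F C"
      unfolding F_def by auto
    then show ?thesis by (simp add: covered_def)
  qed
  have "inf a b \<le> inf (Sup (cyl ` F A)) (Sup (cyl ` F B))"
    using assms by (meson cov inf_mono)
  also have "\<dots> = (SUP c\<in>cyl ` F B. inf (Sup (cyl ` F A)) c)"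
    by (rule inf_Sup_frame)
  also have "\<dots> = (SUP c\<in>cyl ` F B. SUP d\<in>cyl ` F A. inf c d)"
    by (simp only: inf_Sup_frame inf_commute[of "Sup (cyl ` F A)"])
  also have "\<dots> \<le> Sup (cyl ` F (\<lambda>\<phi>. A \<phi> \<and> B \<phi>))"
  proof (clarsimp intro!: SUP_least)
    fix P Q assume "Q \<in> F A" "P \<in> F B"
    then have "P \<union> Q \<in> F (\<lambda>\<phi>. A \<phi> \<and> B \<phi>)" by (auto simp: F_def sat_def)
    moreover have "cyl (P \<union> Q) = inf (cyl P) (cyl Q)" by (simp add: cyl_def INF_union)
    ultimately show "inf (cyl P) (cyl Q) \<le> Sup (cyl ` F (\<lambda>\<phi>. A \<phi> \<and> B \<phi>))"
      by (metis SUP_upper)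
  qed
  finally show ?thesis by (simp add: cov)
qed

text \<open>The values of a pseudo-point at different indices are independent, so by choice an
  unsatisfiable system already fails at a single index \<open>i\<close>. There finitely many open
  sets have empty intersection, and the frame homomorphism \<open>\<rho> i\<close> sends this
  intersection to \<open>bot\<close>.\<close>

lemma cyl_eq_bot:
  assumes fin: "finite P" and sub: "P \<subseteq> carrier G \<times> UNIV" and unsat: "\<And>\<phi>. \<not> sat \<phi> P"
  shows "cyl P = bot"
proof -
  have "\<not> (\<forall>i. \<exists>t. \<forall>U\<in>P `` {i}. t \<in> set_of_opens U)"
  proof
    assume "\<forall>i. \<exists>t. \<forall>U\<in>P `` {i}. t \<in> set_of_opens U"
    from choice[OF this] obtain \<phi> where "\<forall>i. \<forall>U\<in>P `` {i}. \<phi> i \<in> set_of_opens U" ..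
    then have "sat \<phi> P" by (auto simp: sat_def)
    with unsat show False by blast
  qed
  then obtain i where i: "\<And>t. \<not> (\<forall>U\<in>P `` {i}. t \<in> set_of_opens U)" by blast
  have fin': "finite (P `` {i})"
    by (rule finite_subset[OF _ finite_imageI[OF fin, of snd]]) force
  \<comment> \<open>An index without constraints would be satisfied by the value \<open>0\<close>,
    so \<open>i\<close> occurs in \<open>P\<close>.\<close>
  have ic: "i \<in> carrier G" using i[of 0] sub by blast
  have "Inf (P `` {i}) = bot"
    unfolding opens_eq_iff set_of_opens_Inf_finite[OF fin'] set_of_opens_bot using i by blast
  then have "Inf (\<rho> i ` (P `` {i})) = bot"
    using frame_hom_Inf_finite[OF rho_frame_hom[OF ic] fin'] frame_hom_bot[OF rho_frame_hom[OF ic]]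
    by simp
  moreover have "cyl P \<le> Inf (\<rho> i ` (P `` {i}))"
    unfolding cyl_def
  proof (rule INF_greatest)
    fix U assume "U \<in> P `` {i}"
    then have "(i, U) \<in> P" by simp
    then show "(INF (i, U)\<in>P. \<rho> i U) \<le> \<rho> i U" by (rule INF_lower2) simp
  qed
  ultimately show ?thesis by (simp add: bot_unique)
qed

lemma covered_False: "covered a (\<lambda>_. False) \<Longrightarrow> a = bot"
proof -
  assume "covered a (\<lambda>_. False)"
  then have "a \<le> Sup {cyl P | P. finite P \<and> P \<subseteq> carrier G \<times> UNIV \<and> (\<forall>\<phi>. \<not> sat \<phi> P)}"
    by (simp add: covered_def)
  also have "\<dots> \<le> bot" by (rule Sup_least) (clarsimp simp: cyl_eq_bot)
  finally show ?thesis by (simp add: bot_unique)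
qed

section \<open>Values of vector lattice and truncation terms\<close>

lemma evaluates_closed: "evaluates x w \<Longrightarrow> x \<in> carrier G"
  by (simp add: evaluates_def)

lemma evaluates_covered:
  "evaluates x w \<Longrightarrow> open V \<Longrightarrow> covered (\<rho> x (Opens V)) (\<lambda>\<phi>. w \<phi> \<in> V)"
  unfolding evaluates_def by (metis set_of_opens_Opens)

lemma evaluates_var:
  assumes "x \<in> carrier G"
  shows "evaluates x (\<lambda>\<phi>. \<phi> x)"
  unfolding evaluates_def
proof (intro conjI allI assms)
  fix V
  show "covered (\<rho> x V) (\<lambda>\<phi>. \<phi> x \<in> set_of_opens V)"
    unfolding covered_def using assms
    by (intro Sup_upper CollectI exI[of _ "{(x, V)}"]) (simp add: cyl_def sat_def)
qed

lemma evaluates_lift2: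
  assumes "evaluates x v" "evaluates y w" "z \<in> carrier G" "\<rho> z = lift2 f (\<rho> x) (\<rho> y)"
  shows "evaluates z (\<lambda>\<phi>. f (v \<phi>) (w \<phi>))"
  unfolding evaluates_def
proof (intro conjI allI assms)
  fix V
  show "covered (\<rho> z V) (\<lambda>\<phi>. f (v \<phi>) (w \<phi>) \<in> set_of_opens V)"
    unfolding assms(4) lift2_def
  proof (rule covered_Sup, clarsimp)
    fix U1 U2
    assume *: "(\<lambda>(x, y). f x y) ` (set_of_opens U1 \<times> set_of_opens U2) \<subseteq> set_of_opens V"
    have "covered (inf (\<rho> x U1) (\<rho> y U2)) (\<lambda>\<phi>. v \<phi> \<in> set_of_opens U1 \<and> w \<phi> \<in> set_of_opens U2)"
      using assms(1,2) by (intro covered_inf) (auto simp: evaluates_def)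
    then show "covered (inf (\<rho> x U1) (\<rho> y U2)) (\<lambda>\<phi>. f (v \<phi>) (w \<phi>) \<in> set_of_opens V)"
      by (rule covered_mono) (use * in auto)
  qed
qed

lemma evaluates_lift1:
  assumes "evaluates x v" "z \<in> carrier G" "\<rho> z = lift1 f (\<rho> x)"
  shows "evaluates z (\<lambda>\<phi>. f (v \<phi>))"
  unfolding evaluates_def
proof (intro conjI allI assms)
  fix V
  show "covered (\<rho> z V) (\<lambda>\<phi>. f (v \<phi>) \<in> set_of_opens V)"
    unfolding assms(3) lift1_def
  proof (rule covered_Sup, clarsimp)
    fix U
    assume *: "f ` set_of_opens U \<subseteq> set_of_opens V"
    have "covered (\<rho> x U) (\<lambda>\<phi>. v \<phi> \<in> set_of_opens U)"
      using assms(1) by (simp add: evaluates_def)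
    then show "covered (\<rho> x U) (\<lambda>\<phi>. f (v \<phi>) \<in> set_of_opens V)"
      by (rule covered_mono) (use * in auto)
  qed
qed

lemma evaluates_add: "evaluates x v \<Longrightarrow> evaluates y w \<Longrightarrow> evaluates (x \<oplus> y) (\<lambda>\<phi>. v \<phi> + w \<phi>)"
  by (rule evaluates_lift2[of x v y w _ "(+)"]) (simp_all add: rho_ops evaluates_closed)

lemma evaluates_sup: "evaluates x v \<Longrightarrow> evaluates y w \<Longrightarrow> evaluates (x \<curlyvee> y) (\<lambda>\<phi>. max (v \<phi>) (w \<phi>))"
  by (rule evaluates_lift2[of x v y w _ max]) (simp_all add: rho_ops sup_closed evaluates_closed)

lemma evaluates_inf: "evaluates x v \<Longrightarrow> evaluates y w \<Longrightarrow> evaluates (x \<curlywedge> y) (\<lambda>\<phi>. min (v \<phi>) (w \<phi>))"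
  by (rule evaluates_lift2[of x v y w _ min]) (simp_all add: rho_ops inf_closed evaluates_closed)

lemma evaluates_smult: "evaluates x v \<Longrightarrow> evaluates (a \<odot> x) (\<lambda>\<phi>. a * v \<phi>)"
  by (rule evaluates_lift1) (auto simp: rho_smult scal_closed dest: evaluates_closed)

lemma evaluates_vtrunc:
  assumes "evaluates x v" "x \<in> pos G"
  shows "evaluates (vtrunc G x) (\<lambda>\<phi>. min (v \<phi>) 1)"
proof (rule evaluates_lift1[OF assms(1), where f = "\<lambda>t. min t 1"])
  show "vtrunc G x \<in> carrier G" using vtrunc_closed[OF assms(2)] by (simp add: pos_def)
qed (rule rho_vtrunc[OF assms(2)])

text \<open>\<open>trunc_hom\<close> has no clause for the zero, so it is reached through scalar
  multiplication as \<open>0 \<odot> \<zero>\<close>.\<close>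

lemma evaluates_zero: "evaluates \<zero> (\<lambda>_. 0)"
proof -
  have "0 \<odot> \<zero> = \<zero>" using smult_l_null[of \<zero>] by (simp add: ring_of_type_algebra_def)
  then show ?thesis using evaluates_smult[OF evaluates_var[OF M.zero_closed], of 0] by simp
qed

text \<open>Positivity is not an open condition, so it is not a property covering \<open>\<top>\<close>; it is built into
  the evaluation instead.\<close>

lemma evaluates_pos: "x \<in> pos G \<Longrightarrow> evaluates x (\<lambda>\<phi>. max 0 (\<phi> x))"
  using evaluates_sup[OF evaluates_zero evaluates_var[of x]] by (simp add: pos_def vle_def)

lemmas evaluates_intros = evaluates_add evaluates_sup evaluates_inf evaluates_smult
  evaluates_vtrunc evaluates_zero

text \<open>\<open>V\<close> is the join of the intervals of radius \<open>e\<close> whose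
  concentric closed interval of radius \<open>2 * e\<close> stays inside \<open>V\<close>. If
  \<open>v \<phi>\<close> lies in the small interval and \<open>w \<phi>\<close> is within
  \<open>e\<close> of it, then \<open>w \<phi>\<close> cannot leave the large one; so
  \<open>\<rho> x U\<close> is disjoint from \<open>\<rho> y ?W\<close>, while \<open>?W\<close> and
  \<open>V\<close> cover the line.\<close>

lemma rho_le_of_evaluates:
  assumes x: "evaluates x v" and y: "evaluates y w"
    and close: "\<And>e. 0 < e \<Longrightarrow> \<exists>A. covered top A \<and> (\<forall>\<phi>. A \<phi> \<longrightarrow> \<bar>v \<phi> - w \<phi>\<bar> \<le> e)"
  shows "\<rho> x V \<le> \<rho> y V"
proof -
  have hx: "frame_hom (\<rho> x)" and hy: "frame_hom (\<rho> y)"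
    using x y by (auto dest: evaluates_closed rho_frame_hom)
  define B where "B = {Opens {t - e<..<t + e} | t e. 0 < e \<and> {t - 2 * e..t + 2 * e} \<subseteq> set_of_opens V}"
  have "V = Sup B"
  proof (rule opens_eq_iff[THEN iffD2], safe)
    fix t assume "t \<in> set_of_opens V"
    then obtain d where d: "0 < d" "\<And>s. \<bar>s - t\<bar> < d \<Longrightarrow> s \<in> set_of_opens V"
      using open_set_of_opens[of V] unfolding open_dist dist_real_def by blast
    have "{t - 2 * (d / 3)..t + 2 * (d / 3)} \<subseteq> set_of_opens V"
      using d(1) by (auto intro!: d(2))
    then have "Opens {t - d / 3<..<t + d / 3} \<in> B"
      unfolding B_def using d(1) by (intro CollectI exI[of _ t] exI[of _ "d / 3"]) simp
    then show "t \<in> set_of_opens (Sup B)"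
      using d(1) by (auto intro!: bexI[of _ "Opens {t - d / 3<..<t + d / 3}"])
  next
    fix t assume "t \<in> set_of_opens (Sup B)"
    then obtain s e where "t \<in> {s - e<..<s + e}" "0 < e" "{s - 2 * e..s + 2 * e} \<subseteq> set_of_opens V"
      by (auto simp: B_def)
    moreover from this have "t \<in> {s - 2 * e..s + 2 * e}" by simp
    ultimately show "t \<in> set_of_opens V" by blast
  qed
  then have "\<rho> x V = Sup (\<rho> x ` B)" using frame_hom_Sup[OF hx] by metis
  also have "\<dots> \<le> \<rho> y V"
  proof (rule SUP_least)
    fix U assume "U \<in> B"
    then obtain t e where U: "U = Opens {t - e<..<t + e}" and e: "0 < e" "{t - 2 * e..t + 2 * e} \<subseteq> set_of_opens V"
      by (auto simp: B_def)
    obtain A where A: "covered top A" "\<And>\<phi>. A \<phi> \<Longrightarrow> \<bar>v \<phi> - w \<phi>\<bar> \<le> e" using close e(1) by blast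
    let ?W = "Opens (- {t - 2 * e..t + 2 * e})"
    have "covered (inf top (inf (\<rho> x U) (\<rho> y ?W)))
        (\<lambda>\<phi>. A \<phi> \<and> v \<phi> \<in> {t - e<..<t + e} \<and> w \<phi> \<in> - {t - 2 * e..t + 2 * e})"
      unfolding U by (intro covered_inf A evaluates_covered x y) auto
    then have "covered (inf (\<rho> x U) (\<rho> y ?W)) (\<lambda>_. False)"
      by (rule covered_mono) (use A(2) in \<open>fastforce simp: abs_le_iff\<close>)+
    then have "inf (\<rho> x U) (\<rho> y ?W) = bot" by (rule covered_False)
    moreover have "open (- {t - 2 * e..t + 2 * e})" by (intro open_Compl closed_atLeastAtMost)
    then have "sup ?W V = top" using e(2) by (auto simp: opens_eq_iff)
    then have "sup (\<rho> y ?W) (\<rho> y V) = top" using frame_hom_sup[OF hy] frame_hom_top[OF hy] by metis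
    ultimately show "\<rho> x U \<le> \<rho> y V" by (rule frame_le_of_disjoint)
  qed
  finally show ?thesis .
qed

lemma eq_of_evaluates_close:
  assumes x: "evaluates x v" and y: "evaluates y w"
    and close: "\<And>e. 0 < e \<Longrightarrow> \<exists>A. covered top A \<and> (\<forall>\<phi>. A \<phi> \<longrightarrow> \<bar>v \<phi> - w \<phi>\<bar> \<le> e)"
  shows "x = y"
proof -
  have "\<rho> x V = \<rho> y V" for V
    using rho_le_of_evaluates[OF x y close, of V] rho_le_of_evaluates[OF y x, of V] close
    by (simp add: abs_minus_commute antisym)
  then show ?thesis
    using rho_inj x y by (auto dest: evaluates_closed inj_onD)
qed

lemma covered_top: "covered top (\<lambda>_. True)"
  unfolding covered_def by (intro Sup_upper CollectI exI[of _ "{}"]) (simp add: cyl_def)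

lemma eq_of_evaluates: "evaluates x v \<Longrightarrow> evaluates y w \<Longrightarrow> (\<And>\<phi>. v \<phi> = w \<phi>) \<Longrightarrow> x = y"
  by (rule eq_of_evaluates_close) (use covered_top in auto)

text \<open>A non-strict inequality is not an open condition, so a cover may guarantee it only up to
  a slack \<open>e\<close>. Then \<open>max (v \<phi>) (w \<phi>)\<close> is within \<open>e\<close>
  of \<open>w \<phi>\<close>, which is enough for \<open>x \<curlyvee> y = y\<close>.\<close>

lemma le_of_evaluates_close:
  assumes x: "evaluates x v" and y: "evaluates y w"
    and close: "\<And>e. 0 < e \<Longrightarrow> \<exists>A. covered top A \<and> (\<forall>\<phi>. A \<phi> \<longrightarrow> v \<phi> \<le> w \<phi> + e)"
  shows "x \<preceq> y"
  unfolding vle_def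
  by (rule eq_of_evaluates_close[OF evaluates_sup[OF x y] y])
    (use close in \<open>fastforce simp: max_def\<close>)

lemma le_of_evaluates_covered:
  assumes "evaluates x v" "evaluates y w" "covered top A" "\<And>\<phi>. A \<phi> \<Longrightarrow> v \<phi> \<le> w \<phi>"
  shows "x \<preceq> y"
  by (rule le_of_evaluates_close[OF assms(1,2)]) (use assms(3,4) in force)

lemma le_of_evaluates:
  "evaluates x v \<Longrightarrow> evaluates y w \<Longrightarrow> (\<And>\<phi>. v \<phi> \<le> w \<phi>) \<Longrightarrow> x \<preceq> y"
  by (rule le_of_evaluates_covered[OF _ _ covered_top])

lemma posI_evaluates: "evaluates x v \<Longrightarrow> (\<And>\<phi>. 0 \<le> v \<phi>) \<Longrightarrow> x \<in> pos G"
  unfolding pos_def using le_of_evaluates[OF evaluates_zero] evaluates_closed by blast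

definition vdiff :: "'g \<Rightarrow> 'g \<Rightarrow> 'g" where
  "vdiff x y = x \<oplus> (-1) \<odot> y"

lemma evaluates_vdiff: "evaluates x v \<Longrightarrow> evaluates y w \<Longrightarrow> evaluates (vdiff x y) (\<lambda>\<phi>. v \<phi> - w \<phi>)"
  unfolding vdiff_def using evaluates_add[OF _ evaluates_smult[of y w "-1"]] by simp

section \<open>Open rays and pointwise suprema\<close>

lemma le_rho_of_covered:
  assumes a: "covered a A" and y: "evaluates y w" and "r < t" and ge: "\<And>\<phi>. A \<phi> \<Longrightarrow> t \<le> w \<phi>"
  shows "a \<le> \<rho> y (Opens {r<..})"
proof (rule frame_le_of_disjoint)
  have "covered (inf a (\<rho> y (Opens {..<t}))) (\<lambda>\<phi>. A \<phi> \<and> w \<phi> \<in> {..<t})"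
    by (intro covered_inf a evaluates_covered[OF y] open_lessThan)
  then have "covered (inf a (\<rho> y (Opens {..<t}))) (\<lambda>_. False)"
    by (rule covered_mono) (use ge in force)+
  then show "inf a (\<rho> y (Opens {..<t})) = bot" by (rule covered_False)
  have hy: "frame_hom (\<rho> y)" using y by (rule rho_frame_hom[OF evaluates_closed])
  \<comment> \<open>The gap between \<open>r\<close> and \<open>t\<close> lets the two open rays
    cover the line.\<close>
  have "sup (Opens {..<t}) (Opens {r<..}) = top" using \<open>r < t\<close> by (auto simp: opens_eq_iff)
  then show "sup (\<rho> y (Opens {..<t})) (\<rho> y (Opens {r<..})) = top"
    using frame_hom_sup[OF hy] frame_hom_top[OF hy] by metis
qed

text \<open>The open ray above \<open>r\<close> is the union of the open rays above all
  \<open>s > r\<close>, so the gap demanded by \<open>le_rho_of_covered\<close> costs nothing in the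
  end.\<close>

lemma rho_upper_le:
  assumes x: "evaluates x v" and le: "\<And>s. r < s \<Longrightarrow> \<rho> x (Opens {s<..}) \<le> b"
  shows "\<rho> x (Opens {r<..}) \<le> b"
proof -
  have hx: "frame_hom (\<rho> x)" using x by (rule rho_frame_hom[OF evaluates_closed])
  have "Opens {r<..} = Sup ((\<lambda>s. Opens {s<..}) ` {r<..})"
    by (auto simp: opens_eq_iff dest: dense)
  then have "\<rho> x (Opens {r<..}) = (SUP s\<in>{r<..}. \<rho> x (Opens {s<..}))"
    using frame_hom_Sup[OF hx] by (simp add: image_image)
  also have "\<dots> \<le> b" using le by (intro SUP_least) simp
  finally show ?thesis .
qed

lemma rho_upper_mono:
  assumes "x \<in> carrier G" "y \<in> carrier G" "x \<preceq> y"
  shows "\<rho> x (Opens {r<..}) \<le> \<rho> y (Opens {r<..})"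
proof (rule rho_upper_le[OF evaluates_var[OF assms(1)]])
  fix s assume "r < s"
  \<comment> \<open>A pseudo-point need not respect \<open>x \<preceq> y\<close>. Writing
    \<open>y\<close> as \<open>x \<curlyvee> y\<close> makes the inequality hold at every
    pseudo-point.\<close>
  have ev: "evaluates y (\<lambda>\<phi>. max (\<phi> x) (\<phi> y))"
    using evaluates_sup[OF evaluates_var[OF assms(1)] evaluates_var[OF assms(2)]] assms(3)
    by (simp add: vle_def)
  show "\<rho> x (Opens {s<..}) \<le> \<rho> y (Opens {r<..})"
    by (rule le_rho_of_covered[OF evaluates_covered[OF evaluates_var[OF assms(1)]] ev \<open>r < s\<close>]) auto
qed

text \<open>Every pseudo-point at which \<open>h\<close> is below \<open>m\<close> is served by a single index \<open>n\<close>; the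
  elements \<open>\<rho> h (-\<infinity>, m)\<close> join to the top.\<close>

lemma pointwise_supI:
  assumes g: "evaluates g v" and h: "evaluates h u"
    and a: "\<And>n. 0 < n \<Longrightarrow> evaluates (a n) (w n)" and le: "\<And>n \<phi>. 0 < n \<Longrightarrow> w n \<phi> \<le> v \<phi>"
    and reach: "\<And>m r s. 0 < m \<Longrightarrow> r < s \<Longrightarrow>
      \<exists>n>0. \<forall>\<phi>. u \<phi> < real m \<longrightarrow> s < v \<phi> \<longrightarrow> r \<le> w n \<phi>"
  shows "pointwise_sup \<rho> (a ` {0::nat<..}) g"
  unfolding pointwise_sup_def
proof (intro allI antisym)
  fix r
  show "(SUP b\<in>a ` {0<..}. \<rho> b (Opens {r<..})) \<le> \<rho> g (Opens {r<..})"
  proof (clarsimp intro!: SUP_least)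
    fix n :: nat assume n: "0 < n"
    show "\<rho> (a n) (Opens {r<..}) \<le> \<rho> g (Opens {r<..})"
      using le_of_evaluates[OF a[OF n] g le[OF n]] a[OF n] g
      by (intro rho_upper_mono) (auto dest: evaluates_closed)
  qed
  show "\<rho> g (Opens {r<..}) \<le> (SUP b\<in>a ` {0<..}. \<rho> b (Opens {r<..}))" (is "_ \<le> ?S")
  proof (rule rho_upper_le[OF g])
    fix s assume "r < s"
    \<comment> \<open>The midpoint leaves two gaps: \<open>reach\<close> spends the one below
      \<open>s\<close>, and \<open>le_rho_of_covered\<close> the one above \<open>r\<close>.\<close>
    define t where "t = (r + s) / 2"
    have t: "r < t" "t < s" using \<open>r < s\<close> by (simp_all add: t_def field_simps)
    have hh: "frame_hom (\<rho> h)" using h by (rule rho_frame_hom[OF evaluates_closed])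
    have "Sup ((\<lambda>m. Opens {..<real m}) ` {0<..}) = top"
    proof -
      have "\<exists>m\<in>{0<..}. x < real m" for x :: real
      proof -
        obtain m where "x < real m" using reals_Archimedean2 ..
        then show ?thesis by (intro bexI[of _ "Suc m"]) auto
      qed
      then show ?thesis by (auto simp: opens_eq_iff)
    qed
    from arg_cong[OF this, of "\<rho> h"]
    have "(SUP m\<in>{0<..}. \<rho> h (Opens {..<real m})) = top"
      by (simp add: frame_hom_Sup[OF hh] frame_hom_top[OF hh] image_image)
    then have "\<rho> g (Opens {s<..}) = (SUP m\<in>{0<..}. inf (\<rho> g (Opens {s<..})) (\<rho> h (Opens {..<real m})))"
      using inf_Sup_frame[of "\<rho> g (Opens {s<..})" "(\<lambda>m. \<rho> h (Opens {..<real m})) ` {0<..}"]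
      by (simp add: image_image)
    also have "\<dots> \<le> ?S"
    proof (rule SUP_least)
      fix m :: nat assume "m \<in> {0<..}"
      then obtain n where n: "0 < n" "\<And>\<phi>. u \<phi> < real m \<Longrightarrow> s < v \<phi> \<Longrightarrow> t \<le> w n \<phi>"
        using reach[of m t s] t by auto
      have "covered (inf (\<rho> g (Opens {s<..})) (\<rho> h (Opens {..<real m})))
          (\<lambda>\<phi>. v \<phi> \<in> {s<..} \<and> u \<phi> \<in> {..<real m})"
        by (intro covered_inf evaluates_covered g h) auto
      then have "inf (\<rho> g (Opens {s<..})) (\<rho> h (Opens {..<real m})) \<le> \<rho> (a n) (Opens {r<..})"
        by (rule le_rho_of_covered[OF _ a[OF n(1)] t(1)]) (use n(2) in auto)
      also have "\<dots> \<le> ?S" using n(1) by (intro SUP_upper) simp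
      finally show "inf (\<rho> g (Opens {s<..})) (\<rho> h (Opens {..<real m})) \<le> ?S" .
    qed
    finally show "\<rho> g (Opens {s<..}) \<le> ?S" .
  qed
qed

end

section \<open>Convex subtruncs\<close>

locale convex_madden_representation = madden_representation G pL pM q \<rho> ext
  for G :: "'g vlat" (structure)
    and pL :: "'l::frame \<Rightarrow> bool" and pM :: "'m::frame \<Rightarrow> bool"
    and q :: "'m \<Rightarrow> 'l" and \<rho> :: "'g \<Rightarrow> real opens \<Rightarrow> 'l" and ext :: "'g \<Rightarrow> ereal opens \<Rightarrow> 'm" +
  fixes K :: "'g set"
  assumes convex: "convex_subtrunc G K"
begin

lemma K_submodule: "submodule K (ring_of_type_algebra :: real ring) G"
  using convex unfolding convex_subtrunc_def by blast

lemma K_subgroup: "subgroup K (add_monoid G)"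
  using K_submodule by (rule submodule.axioms)

lemma K_subset: "K \<subseteq> carrier G"
  using subgroup.subset[OF K_subgroup] by simp

lemma K_zero: "\<zero> \<in> K"
  using subgroup.one_closed[OF K_subgroup] by simp

lemma K_add: "x \<in> K \<Longrightarrow> y \<in> K \<Longrightarrow> x \<oplus> y \<in> K"
  using subgroup.m_closed[OF K_subgroup, of x y] by simp

lemma K_smult: "x \<in> K \<Longrightarrow> a \<odot> x \<in> K"
  using submodule.smult_closed[OF K_submodule, of a x] by (simp add: ring_of_type_algebra_def)

lemma K_sup: "x \<in> K \<Longrightarrow> y \<in> K \<Longrightarrow> x \<curlyvee> y \<in> K"
  using convex unfolding convex_subtrunc_def by blast

lemma K_convex: "x \<in> K \<Longrightarrow> z \<in> K \<Longrightarrow> y \<in> carrier G \<Longrightarrow> x \<preceq> y \<Longrightarrow> y \<preceq> z \<Longrightarrow> y \<in> K"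
  using convex unfolding convex_subtrunc_def by blast

lemma K_vdiff: "x \<in> K \<Longrightarrow> y \<in> K \<Longrightarrow> vdiff x y \<in> K"
  by (simp add: vdiff_def K_add K_smult)

text \<open>The join of \<open>k\<close> and its negative is the absolute value of \<open>k\<close>,
  so \<open>?a\<close> is a sum of two absolute values in \<open>K\<close>, and \<open>x\<close>
  lies between \<open>?a\<close> and its negative. Two dominating elements are allowed so that
  congruences in both arguments of a binary operation can be used at once.\<close>

lemma K_dominated2:
  assumes x: "evaluates x v" and k: "k \<in> K" "evaluates k w" and k': "k' \<in> K" "evaluates k' w'"
    and A: "covered top A" and le: "\<And>\<phi>. A \<phi> \<Longrightarrow> \<bar>v \<phi>\<bar> \<le> \<bar>w \<phi>\<bar> + \<bar>w' \<phi>\<bar>"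
  shows "x \<in> K"
proof -
  let ?a = "(k \<curlyvee> (-1) \<odot> k) \<oplus> (k' \<curlyvee> (-1) \<odot> k')"
  have ev: "evaluates ?a (\<lambda>\<phi>. max (w \<phi>) (-1 * w \<phi>) + max (w' \<phi>) (-1 * w' \<phi>))"
    by (intro evaluates_intros k k')
  show ?thesis
  proof (rule K_convex[of "(-1) \<odot> ?a" ?a])
    show "?a \<in> K" "(-1) \<odot> ?a \<in> K" by (simp_all add: K_add K_smult K_sup k k')
    show "x \<preceq> ?a" by (rule le_of_evaluates_covered[OF x ev A]) (use le in force)
    show "(-1) \<odot> ?a \<preceq> x"
      by (rule le_of_evaluates_covered[OF evaluates_smult[OF ev] x A]) (use le in force)
  qed (rule evaluates_closed[OF x])
qed

lemma K_dominated:
  assumes "evaluates x v" "k \<in> K" "evaluates k w" "\<And>\<phi>. \<bar>v \<phi>\<bar> \<le> \<bar>w \<phi>\<bar>"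
  shows "x \<in> K"
  by (rule K_dominated2[OF assms(1-3) K_zero evaluates_zero covered_top]) (use assms(4) in simp)

text \<open>These conditions say that the quotient of \<open>G\<close> by \<open>K\<close> is archimedean and satisfies the last
  two axioms of a truncation; the remaining trunc axioms pass to the quotient for free. Since
  \<open>x \<curlyvee> y - y\<close> is the positive part of \<open>x - y\<close>, its membership in \<open>K\<close> means that \<open>x \<le> y\<close>
  holds modulo \<open>K\<close>.\<close>

definition quotient_is_trunc :: bool where
  "quotient_is_trunc \<longleftrightarrow>
     (\<forall>x\<in>pos G. \<forall>y\<in>pos G. (\<forall>n>0. vdiff (real n \<odot> x \<curlyvee> y) y \<in> K) \<longrightarrow> x \<in> K) \<and>
     (\<forall>g\<in>pos G. vtrunc G g \<in> K \<longrightarrow> g \<in> K) \<and>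
     (\<forall>g\<in>pos G. (\<forall>n>0. vdiff (real n \<odot> g) (vtrunc G (real n \<odot> g)) \<in> K) \<longrightarrow> g \<in> K)"

lemma quotient_archimedeanD:
  "\<lbrakk>quotient_is_trunc; x \<in> pos G; y \<in> pos G; \<And>n. 0 < n \<Longrightarrow> vdiff (real n \<odot> x \<curlyvee> y) y \<in> K\<rbrakk> \<Longrightarrow> x \<in> K"
  unfolding quotient_is_trunc_def by blast

lemma quotient_vtruncD: "\<lbrakk>quotient_is_trunc; g \<in> pos G; vtrunc G g \<in> K\<rbrakk> \<Longrightarrow> g \<in> K"
  unfolding quotient_is_trunc_def by blast

lemma quotient_multiplesD:
  "\<lbrakk>quotient_is_trunc; g \<in> pos G; \<And>n. 0 < n \<Longrightarrow> vdiff (real n \<odot> g) (vtrunc G (real n \<odot> g)) \<in> K\<rbrakk>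
    \<Longrightarrow> g \<in> K"
  unfolding quotient_is_trunc_def by blast

lemma scal_pos: "x \<in> pos G \<Longrightarrow> real n \<odot> x \<in> pos G"
  by (simp add: smult_pos)

lemma pointwise_closedD:
  assumes "pointwise_closed G \<rho> K" "pointwise_sup \<rho> (a ` {0::nat<..}) g" "g \<in> carrier G"
    and "\<And>n. 0 < n \<Longrightarrow> a n \<in> K" "\<And>n. 0 < n \<Longrightarrow> a n \<in> pos G"
  shows "g \<in> K"
proof -
  have "a ` {0<..} \<subseteq> K \<inter> pos G" using assms(4,5) by auto
  with assms(1-3) show ?thesis unfolding pointwise_closed_def by blast
qed

lemma pos_closed: "x \<in> pos G \<Longrightarrow> x \<in> carrier G"
  by (simp add: pos_def)

subsection \<open>Pointwise closed sets\<close>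

lemma quotient_archimedean_of_closed:
  assumes closed: "pointwise_closed G \<rho> K" and x: "x \<in> pos G" and y: "y \<in> pos G"
    and K: "\<And>n. 0 < n \<Longrightarrow> vdiff (real n \<odot> x \<curlyvee> y) y \<in> K"
  shows "x \<in> K"
proof -
  define a where "a n = (1 / real n) \<odot> vdiff (real n \<odot> x \<curlyvee> y) y" for n
  define w where "w n \<phi> = 1 / real n * (max (real n * max 0 (\<phi> x)) (max 0 (\<phi> y)) - max 0 (\<phi> y))"
    for n \<phi>
  have ev: "evaluates (a n) (w n)" for n
    unfolding a_def w_def by (intro evaluates_intros evaluates_vdiff evaluates_pos x y)
  have "pointwise_sup \<rho> (a ` {0<..}) x"
  proof (rule pointwise_supI[OF evaluates_pos[OF x] evaluates_pos[OF y] ev])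
    fix n :: nat and \<phi> assume "0 < n"
    then show "w n \<phi> \<le> max 0 (\<phi> x)"
      by (auto simp: w_def field_simps max_def)
  next
    fix m :: nat and r s :: real assume m: "0 < m" and rs: "r < s"
    \<comment> \<open>Where \<open>y\<close> is below \<open>m\<close>, the amount
      \<open>y / n\<close> subtracted from \<open>x\<close> is then less than
      \<open>s - r\<close>.\<close>
    obtain n where n: "real m / (s - r) < real n" using reals_Archimedean2 ..
    have "0 < real m / (s - r)" using m rs by simp
    with n have "0 < real n" by linarith
    then have "0 < n" by simp
    moreover have "r \<le> w n \<phi>" if "max 0 (\<phi> y) < real m" "s < max 0 (\<phi> x)" for \<phi>
    proof -
      have "real m < real n * (s - r)" using n rs by (simp add: field_simps)
      moreover have "real n * s \<le> real n * max 0 (\<phi> x)" using that by (simp add: mult_left_mono)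
      ultimately have "real n * r \<le> real n * max 0 (\<phi> x) - max 0 (\<phi> y)"
        using that(1) unfolding right_diff_distrib by linarith
      also have "\<dots> \<le> real n * w n \<phi>" using \<open>0 < n\<close> by (simp add: w_def)
      finally show ?thesis using \<open>0 < n\<close> by simp
    qed
    ultimately show "\<exists>n>0. \<forall>\<phi>. max 0 (\<phi> y) < real m \<longrightarrow> s < max 0 (\<phi> x) \<longrightarrow> r \<le> w n \<phi>"
      by blast
  qed
  then show ?thesis
  proof (rule pointwise_closedD[OF closed _ pos_closed[OF x]])
    fix n :: nat assume n: "0 < n"
    show "a n \<in> K" unfolding a_def by (intro K_smult K n)
    show "a n \<in> pos G" by (rule posI_evaluates[OF ev]) (simp add: w_def)
  qed
qed

lemma quotient_vtrunc_of_closed: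
  assumes closed: "pointwise_closed G \<rho> K" and g: "g \<in> pos G" and K: "vtrunc G g \<in> K"
  shows "g \<in> K"
proof -
  define a where "a n = g \<curlywedge> (real n \<odot> vtrunc G g)" for n
  define w where "w n \<phi> = min (max 0 (\<phi> g)) (real n * min (max 0 (\<phi> g)) 1)" for n \<phi>
  have ev: "evaluates (a n) (w n)" for n
    unfolding a_def w_def by (intro evaluates_intros evaluates_pos g)
  have "pointwise_sup \<rho> (a ` {0<..}) g"
  proof (rule pointwise_supI[OF evaluates_pos[OF g] evaluates_pos[OF g] ev])
    fix m :: nat and r s :: real assume m: "0 < m" and rs: "r < s"
    \<comment> \<open>The index \<open>m\<close> itself serves: where \<open>g \<le> 1\<close>, the
      multiple \<open>m * min g 1\<close> is at least \<open>g\<close>, and where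
      \<open>1 < g < m\<close> it equals \<open>m\<close>, which exceeds \<open>g\<close>.\<close>
    have "r \<le> w m \<phi>" if "max 0 (\<phi> g) < real m" "s < max 0 (\<phi> g)" for \<phi>
    proof -
      define t where "t = max 0 (\<phi> g)"
      have "0 \<le> t" "s < t" "t < real m" using that by (simp_all add: t_def)
      moreover have "1 * t \<le> real m * t" if "t \<le> 1"
        using m \<open>0 \<le> t\<close> by (intro mult_right_mono) auto
      ultimately have "r \<le> min t (real m * min t 1)"
        using rs by (cases "t \<le> 1") (auto simp: min_def)
      then show ?thesis by (simp add: w_def t_def)
    qed
    then show "\<exists>n>0. \<forall>\<phi>. max 0 (\<phi> g) < real m \<longrightarrow> s < max 0 (\<phi> g) \<longrightarrow> r \<le> w n \<phi>"
      using m by blast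
  qed (simp add: w_def)
  then show ?thesis
  proof (rule pointwise_closedD[OF closed _ pos_closed[OF g]])
    fix n :: nat assume n: "0 < n"
    have T: "evaluates (vtrunc G g) (\<lambda>\<phi>. min (max 0 (\<phi> g)) 1)"
      by (intro evaluates_intros evaluates_pos g)
    show "a n \<in> K"
      by (rule K_dominated[OF ev K_smult[OF K] evaluates_smult[OF T, of "real n"]])
        (simp add: w_def abs_of_nonneg)
    show "a n \<in> pos G" by (rule posI_evaluates[OF ev]) (simp add: w_def)
  qed
qed

lemma quotient_multiples_of_closed:
  assumes closed: "pointwise_closed G \<rho> K" and g: "g \<in> pos G"
    and K: "\<And>n. 0 < n \<Longrightarrow> vdiff (real n \<odot> g) (vtrunc G (real n \<odot> g)) \<in> K"
  shows "g \<in> K"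
proof -
  \<comment> \<open>This is \<open>(g - 1 / n)\<^sup>+\<close>, because subtracting
    \<open>min (n * g) 1\<close> from \<open>n * g\<close> leaves the positive part of
    \<open>n * g - 1\<close>.\<close>
  define a where "a n = (1 / real n) \<odot> vdiff (real n \<odot> g) (vtrunc G (real n \<odot> g))" for n
  define w where "w n \<phi> = 1 / real n * (real n * max 0 (\<phi> g) - min (real n * max 0 (\<phi> g)) 1)"
    for n \<phi>
  have ev: "evaluates (a n) (w n)" for n
    unfolding a_def w_def by (intro evaluates_intros evaluates_vdiff evaluates_pos g scal_pos)
  have "pointwise_sup \<rho> (a ` {0<..}) g"
  proof (rule pointwise_supI[OF evaluates_pos[OF g] evaluates_pos[OF g] ev])
    fix n :: nat and \<phi> assume "0 < n"
    then show "w n \<phi> \<le> max 0 (\<phi> g)"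
      by (auto simp: w_def field_simps max_def min_def)
  next
    fix m :: nat and r s :: real assume m: "0 < m" and rs: "r < s"
    obtain n where n: "1 / (s - r) < real n" using reals_Archimedean2 ..
    have "0 < 1 / (s - r)" using rs by simp
    with n have "0 < real n" by linarith
    then have "0 < n" by simp
    moreover have "r \<le> w n \<phi>" if "s < max 0 (\<phi> g)" for \<phi>
    proof -
      have "1 < real n * (s - r)" using n rs by (simp add: field_simps)
      moreover have "real n * s \<le> real n * max 0 (\<phi> g)" using that by (simp add: mult_left_mono)
      ultimately have "real n * r \<le> real n * max 0 (\<phi> g) - 1"
        unfolding right_diff_distrib by linarith
      also have "\<dots> \<le> real n * w n \<phi>" using \<open>0 < n\<close> by (simp add: w_def)
      finally show ?thesis using \<open>0 < n\<close> by simp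
    qed
    ultimately show "\<exists>n>0. \<forall>\<phi>. max 0 (\<phi> g) < real m \<longrightarrow> s < max 0 (\<phi> g) \<longrightarrow> r \<le> w n \<phi>"
      by blast
  qed
  then show ?thesis
  proof (rule pointwise_closedD[OF closed _ pos_closed[OF g]])
    fix n :: nat assume n: "0 < n"
    show "a n \<in> K" unfolding a_def by (intro K_smult K n)
    show "a n \<in> pos G" by (rule posI_evaluates[OF ev]) (simp add: w_def)
  qed
qed

lemma quotient_is_trunc_of_closed:
  assumes "pointwise_closed G \<rho> K"
  shows "quotient_is_trunc"
  unfolding quotient_is_trunc_def
  using quotient_archimedean_of_closed[OF assms] quotient_vtrunc_of_closed[OF assms]
    quotient_multiples_of_closed[OF assms] by blast

subsection \<open>Kernels\<close>

text \<open>A difference lies in the kernel exactly when \<open>\<theta>\<close> identifies its two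
  terms, so each clause is the corresponding axiom of \<open>H\<close> pulled back along
  \<open>\<theta>\<close>.\<close>

lemma quotient_is_trunc_of_kernel:
  assumes "truncation_kernel G K"
  shows "quotient_is_trunc"
proof -
  obtain H :: "'g vlat" and \<theta> where H: "trunc H" and hom: "\<theta> \<in> trunc_hom G H"
    and ker: "K = {g \<in> carrier G. \<theta> g = \<zero>\<^bsub>H\<^esub>}"
    using assms by (auto simp: truncation_kernel_def)
  interpret H: trunc H by (rule H)
  have th: "\<And>x. x \<in> carrier G \<Longrightarrow> \<theta> x \<in> carrier H"
    "\<And>x y. \<lbrakk>x \<in> carrier G; y \<in> carrier G\<rbrakk> \<Longrightarrow> \<theta> (x \<oplus> y) = \<theta> x \<oplus>\<^bsub>H\<^esub> \<theta> y"
    "\<And>a x. x \<in> carrier G \<Longrightarrow> \<theta> (a \<odot> x) = a \<odot>\<^bsub>H\<^esub> \<theta> x"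
    "\<And>x y. \<lbrakk>x \<in> carrier G; y \<in> carrier G\<rbrakk> \<Longrightarrow> \<theta> (x \<curlyvee> y) = \<theta> x \<curlyvee>\<^bsub>H\<^esub> \<theta> y"
    "\<And>g. g \<in> pos G \<Longrightarrow> \<theta> (vtrunc G g) = vtrunc H (\<theta> g)"
    using hom by (auto simp: trunc_hom_def)
  have zero: "\<theta> \<zero> = \<zero>\<^bsub>H\<^esub>" using K_zero ker by blast
  have eq: "\<theta> x = \<theta> y" if K: "vdiff x y \<in> K" and xy: "x \<in> carrier G" "y \<in> carrier G" for x y
  proof -
    have "vdiff x y \<oplus> y = x"
      by (rule eq_of_evaluates[OF evaluates_add[OF evaluates_vdiff[OF evaluates_var evaluates_var]
            evaluates_var] evaluates_var]) (simp_all add: xy)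
    then have "\<theta> x = \<theta> (vdiff x y) \<oplus>\<^bsub>H\<^esub> \<theta> y"
      using th(2)[of "vdiff x y" y] K K_subset xy by auto
    then show ?thesis using K ker th(1) xy by simp
  qed
  have pos: "\<theta> x \<in> pos H" if "x \<in> pos G" for x
    using that th(1)[of x] th(4)[of \<zero> x] zero by (simp add: pos_def vle_def)
  have tc: "vtrunc G x \<in> carrier G" if "x \<in> pos G" for x
    using vtrunc_closed[OF that] by (rule pos_closed)
  have memI: "x \<in> K" if "x \<in> pos G" "\<theta> x = \<zero>\<^bsub>H\<^esub>" for x
    using that ker by (simp add: pos_closed)
  show ?thesis
    unfolding quotient_is_trunc_def
  proof (intro conjI ballI impI)
    fix x y assume x: "x \<in> pos G" and y: "y \<in> pos G"
      and K: "\<forall>n>0. vdiff (real n \<odot> x \<curlyvee> y) y \<in> K"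
    have "\<theta> x = \<zero>\<^bsub>H\<^esub>"
    proof (rule H.archimedean[OF pos[OF x] th(1)[OF pos_closed[OF y]]])
      fix n :: nat assume "0 < n"
      then have "\<theta> (real n \<odot> x \<curlyvee> y) = \<theta> y"
        using K x y by (intro eq) (simp_all add: pos_closed sup_closed scal_closed)
      then show "real n \<odot>\<^bsub>H\<^esub> \<theta> x \<preceq>\<^bsub>H\<^esub> \<theta> y"
        using x y by (simp add: vle_def th pos_closed scal_closed)
    qed
    then show "x \<in> K" by (rule memI[OF x])
  next
    fix g assume g: "g \<in> pos G" and "vtrunc G g \<in> K"
    then have "vtrunc H (\<theta> g) = \<zero>\<^bsub>H\<^esub>" using th(5)[OF g] ker by simp
    then show "g \<in> K" using H.vtrunc_eq_zero[OF pos[OF g]] memI[OF g] by blast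
  next
    fix g assume g: "g \<in> pos G" and K: "\<forall>n>0. vdiff (real n \<odot> g) (vtrunc G (real n \<odot> g)) \<in> K"
    have "\<theta> g = \<zero>\<^bsub>H\<^esub>"
    proof (rule H.vtrunc_multiples[OF pos[OF g]])
      fix n :: nat assume n: "0 < n"
      have "\<theta> (real n \<odot> g) = \<theta> (vtrunc G (real n \<odot> g))"
        using K n g by (intro eq) (simp_all add: pos_closed scal_closed tc scal_pos)
      then show "real n \<odot>\<^bsub>H\<^esub> \<theta> g = vtrunc H (real n \<odot>\<^bsub>H\<^esub> \<theta> g)"
        using th(3)[OF pos_closed[OF g], of "real n"] th(5)[OF scal_pos[OF g], of n] by simp
    qed
    then show "g \<in> K" by (rule memI[OF g])
  qed
qed

subsection \<open>The quotient\<close>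

text \<open>The quotient is carried by a system of representatives, so that it lives in the type of \<open>G\<close>.\<close>

definition rep :: "'g \<Rightarrow> 'g" where
  "rep x = (SOME z. z \<in> carrier G \<and> vdiff x z \<in> K)"

text \<open>The representative of a positive class need not be positive, while the axioms govern
  \<open>vtrunc G\<close> only on \<open>pos G\<close>; hence the join with \<open>\<zero>\<close>
  before truncating.\<close>

definition quot_vlat :: "'g vlat" where
  "quot_vlat = \<lparr> carrier = rep ` carrier G, monoid.mult = undefined, one = undefined,
     ring.zero = rep \<zero>, add = (\<lambda>x y. rep (x \<oplus> y)), module.smult = (\<lambda>a x. rep (a \<odot> x)),
     vsup = (\<lambda>x y. rep (x \<curlyvee> y)), vinf = (\<lambda>x y. rep (x \<curlywedge> y)),
     vtrunc = (\<lambda>x. rep (vtrunc G (\<zero> \<curlyvee> x))) \<rparr>"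

text \<open>Addition, join and meet of reals change by at most the sum of the changes of their
  arguments. Such a pointwise estimate is all that compatibility with congruence modulo
  \<open>K\<close> requires, and the triangle inequality gives transitivity in the same way.\<close>

lemma vdiff_K:
  assumes "evaluates x v" "evaluates x' v'" "evaluates y w" "evaluates y' w'"
    and "vdiff x x' \<in> K" "vdiff y y' \<in> K" "evaluates a f" "evaluates b g"
    and "\<And>\<phi>. \<bar>f \<phi> - g \<phi>\<bar> \<le> \<bar>v \<phi> - v' \<phi>\<bar> + \<bar>w \<phi> - w' \<phi>\<bar>"
  shows "vdiff a b \<in> K"
  by (rule K_dominated2[OF evaluates_vdiff[OF assms(7,8)] assms(5) evaluates_vdiff[OF assms(1,2)]
        assms(6) evaluates_vdiff[OF assms(3,4)] covered_top assms(9)])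

lemma vdiff_self: "x \<in> carrier G \<Longrightarrow> vdiff x x \<in> K"
  by (rule K_dominated[OF evaluates_vdiff[OF evaluates_var evaluates_var] K_zero evaluates_zero]) simp_all

lemma rep_spec: "x \<in> carrier G \<Longrightarrow> rep x \<in> carrier G \<and> vdiff x (rep x) \<in> K"
  unfolding rep_def by (rule someI[of _ x]) (simp add: vdiff_self)

text \<open>Congruent elements define the same predicate in the choice operator \<open>SOME\<close>,
  and so receive the same representative, not merely congruent ones.\<close>

lemma rep_eq_iff:
  assumes x: "x \<in> carrier G" and y: "y \<in> carrier G"
  shows "rep x = rep y \<longleftrightarrow> vdiff x y \<in> K"
proof
  have ev: "evaluates (rep y) (\<lambda>\<phi>. \<phi> (rep y))" using rep_spec[OF y] by (intro evaluates_var) simp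
  assume "rep x = rep y"
  then have "vdiff x (rep y) \<in> K" using rep_spec[OF x] by simp
  then show "vdiff x y \<in> K"
    by (rule vdiff_K[OF evaluates_var[OF x] ev evaluates_var[OF y] ev _
          conjunct2[OF rep_spec[OF y]] evaluates_var[OF x] evaluates_var[OF y]]) linarith
next
  assume xy: "vdiff x y \<in> K"
  have "vdiff x z \<in> K \<longleftrightarrow> vdiff y z \<in> K" if z: "z \<in> carrier G" for z
  proof
    note ev = evaluates_var[OF x] evaluates_var[OF y] evaluates_var[OF z]
    show "vdiff y z \<in> K" if "vdiff x z \<in> K"
      by (rule vdiff_K[OF ev(1,2) ev(1,3) xy that ev(2,3)]) linarith
    show "vdiff x z \<in> K" if "vdiff y z \<in> K"
      by (rule vdiff_K[OF ev(1,2) ev(2,3) xy that ev(1,3)]) linarith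
  qed
  then show "rep x = rep y" unfolding rep_def by metis
qed

lemma rep_eqI:
  "\<lbrakk>evaluates x v; evaluates y w; k \<in> K; evaluates k u; \<And>\<phi>. \<bar>v \<phi> - w \<phi>\<bar> \<le> \<bar>u \<phi>\<bar>\<rbrakk> \<Longrightarrow> rep x = rep y"
  using K_dominated[OF evaluates_vdiff] rep_eq_iff evaluates_closed by metis

lemma rep_cong2:
  assumes x: "x \<in> carrier G" and y: "y \<in> carrier G"
    and ev: "\<And>x y. x \<in> carrier G \<Longrightarrow> y \<in> carrier G \<Longrightarrow> evaluates (F x y) (\<lambda>\<phi>. f (\<phi> x) (\<phi> y))"
    and lip: "\<And>a b c d. \<bar>f a b - f c d\<bar> \<le> \<bar>a - c\<bar> + \<bar>b - d\<bar>"
  shows "rep (F (rep x) (rep y)) = rep (F x y)"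
proof -
  note r = rep_spec[OF x] rep_spec[OF y]
  have "vdiff (F x y) (F (rep x) (rep y)) \<in> K"
    by (rule vdiff_K[OF evaluates_var evaluates_var evaluates_var evaluates_var _ _ ev ev,
          of x "rep x" y "rep y"]) (use x y r in \<open>simp_all add: lip\<close>)
  then show ?thesis
    using rep_eq_iff[of "F x y" "F (rep x) (rep y)"] ev[OF x y] ev[of "rep x" "rep y"] r
    by (simp add: evaluates_closed)
qed

lemma rep_hom:
  assumes x: "x \<in> carrier G" and y: "y \<in> carrier G"
  shows "rep (rep x \<oplus> rep y) = rep (x \<oplus> y)" "rep (rep x \<curlyvee> rep y) = rep (x \<curlyvee> y)"
    "rep (rep x \<curlywedge> rep y) = rep (x \<curlywedge> y)" "rep (a \<odot> rep x) = rep (a \<odot> x)"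
    "rep (vtrunc G (\<zero> \<curlyvee> rep x)) = rep (vtrunc G (\<zero> \<curlyvee> x))"
proof -
  show "rep (rep x \<oplus> rep y) = rep (x \<oplus> y)"
    by (rule rep_cong2[OF x y, of "\<lambda>x y. x \<oplus> y" "(+)"])
      (intro evaluates_intros evaluates_var | assumption | simp add: abs_if)+
  show "rep (rep x \<curlyvee> rep y) = rep (x \<curlyvee> y)"
    by (rule rep_cong2[OF x y, of "\<lambda>x y. x \<curlyvee> y" max])
      (intro evaluates_intros evaluates_var | assumption | simp add: abs_if max_def)+
  show "rep (rep x \<curlywedge> rep y) = rep (x \<curlywedge> y)"
    by (rule rep_cong2[OF x y, of "\<lambda>x y. x \<curlywedge> y" min])
      (intro evaluates_intros evaluates_var | assumption | simp add: abs_if min_def)+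
  note r = rep_spec[OF x]
  have rx: "rep x \<in> carrier G" using r by simp
  note k = conjunct2[OF r] evaluates_vdiff[OF evaluates_var[OF x] evaluates_var[OF rx]]
  show "rep (a \<odot> rep x) = rep (a \<odot> x)"
    by (rule rep_eqI[OF evaluates_smult[OF evaluates_var[OF rx]] evaluates_smult[OF evaluates_var[OF x]]
          K_smult[OF k(1), of a] evaluates_smult[OF k(2)]])
      (simp add: abs_mult abs_minus_commute flip: right_diff_distrib)
  have pos: "\<zero> \<curlyvee> z \<in> pos G" if "z \<in> carrier G" for z
    by (rule posI_evaluates[OF evaluates_sup[OF evaluates_zero evaluates_var[OF that]]]) simp
  have ev: "evaluates (vtrunc G (\<zero> \<curlyvee> z)) (\<lambda>\<phi>. min (max 0 (\<phi> z)) 1)" if z: "z \<in> carrier G" for z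
    by (intro evaluates_intros evaluates_var pos z)
  show "rep (vtrunc G (\<zero> \<curlyvee> rep x)) = rep (vtrunc G (\<zero> \<curlyvee> x))"
    by (rule rep_eqI[OF ev[OF rx] ev[OF x] k]) (auto simp: abs_if min_def max_def)
qed

lemma quotient_ops:
  "carrier quot_vlat = rep ` carrier G" "\<zero>\<^bsub>quot_vlat\<^esub> = rep \<zero>"
  "\<And>x y. \<lbrakk>x \<in> carrier G; y \<in> carrier G\<rbrakk> \<Longrightarrow> rep x \<oplus>\<^bsub>quot_vlat\<^esub> rep y = rep (x \<oplus> y)"
  "\<And>a x. x \<in> carrier G \<Longrightarrow> a \<odot>\<^bsub>quot_vlat\<^esub> rep x = rep (a \<odot> x)"
  "\<And>x y. \<lbrakk>x \<in> carrier G; y \<in> carrier G\<rbrakk> \<Longrightarrow> rep x \<curlyvee>\<^bsub>quot_vlat\<^esub> rep y = rep (x \<curlyvee> y)"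
  "\<And>x y. \<lbrakk>x \<in> carrier G; y \<in> carrier G\<rbrakk> \<Longrightarrow> rep x \<curlywedge>\<^bsub>quot_vlat\<^esub> rep y = rep (x \<curlywedge> y)"
  by (simp_all add: quot_vlat_def rep_hom)

lemma quotient_vtrunc: "x \<in> pos G \<Longrightarrow> vtrunc quot_vlat (rep x) = rep (vtrunc G x)"
  using rep_hom(5)[of x \<zero>] by (simp add: quot_vlat_def pos_def vle_def)

lemma quotient_le_iff:
  "\<lbrakk>x \<in> carrier G; y \<in> carrier G\<rbrakk> \<Longrightarrow> rep x \<preceq>\<^bsub>quot_vlat\<^esub> rep y \<longleftrightarrow> vdiff (x \<curlyvee> y) y \<in> K"
  by (simp add: vle_def quotient_ops rep_eq_iff sup_closed)

lemma quotient_mono: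
  "\<lbrakk>x \<in> carrier G; y \<in> carrier G; x \<preceq> y\<rbrakk> \<Longrightarrow> rep x \<preceq>\<^bsub>quot_vlat\<^esub> rep y"
  by (simp add: vle_def quotient_ops)

lemma quotient_posE:
  assumes "i \<in> pos quot_vlat"
  obtains x where "x \<in> pos G" "i = rep x"
proof -
  obtain x where x: "x \<in> carrier G" "i = rep x" using assms by (auto simp: pos_def quotient_ops)
  have "\<zero> \<curlyvee> x \<in> pos G"
    by (rule posI_evaluates[OF evaluates_sup[OF evaluates_zero evaluates_var[OF x(1)]]]) simp
  moreover have "i = rep (\<zero> \<curlyvee> x)" using assms x by (simp add: pos_def vle_def quotient_ops)
  ultimately show ?thesis by (rule that)
qed

lemma rep_pos: "x \<in> pos G \<Longrightarrow> rep x \<in> pos quot_vlat"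
  unfolding pos_def using quotient_mono[of \<zero> x] by (simp add: quotient_ops)

lemma quotient_module: "module (ring_of_type_algebra :: real ring) quot_vlat"
proof (rule moduleI)
  have R: "carrier (ring_of_type_algebra :: real ring) = UNIV"
    "\<And>x y. x \<oplus>\<^bsub>ring_of_type_algebra :: real ring\<^esub> y = x + y"
    "\<And>x y. x \<otimes>\<^bsub>ring_of_type_algebra :: real ring\<^esub> y = x * y"
    "\<one>\<^bsub>ring_of_type_algebra :: real ring\<^esub> = 1"
    by (simp_all add: ring_of_type_algebra_def)
  show "cring (ring_of_type_algebra :: real ring)" by (rule cring_from_type_algebra)
  show "abelian_group quot_vlat"
  proof (rule abelian_groupI)
    fix i assume "i \<in> carrier quot_vlat"
    then obtain x where x: "x \<in> carrier G" "i = rep x" by (auto simp: quotient_ops)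
    then show "\<exists>j\<in>carrier quot_vlat. j \<oplus>\<^bsub>quot_vlat\<^esub> i = \<zero>\<^bsub>quot_vlat\<^esub>"
      by (intro bexI[of _ "rep (\<ominus> x)"]) (simp_all add: quotient_ops M.l_neg)
  qed (auto simp: quotient_ops M.a_ac)
  fix a b i assume "i \<in> carrier quot_vlat"
  then obtain x where x: "x \<in> carrier G" "i = rep x" by (auto simp: quotient_ops)
  show "a \<odot>\<^bsub>quot_vlat\<^esub> i \<in> carrier quot_vlat" using x by (simp add: quotient_ops scal_closed)
  show "(a \<oplus>\<^bsub>ring_of_type_algebra\<^esub> b) \<odot>\<^bsub>quot_vlat\<^esub> i
      = a \<odot>\<^bsub>quot_vlat\<^esub> i \<oplus>\<^bsub>quot_vlat\<^esub> b \<odot>\<^bsub>quot_vlat\<^esub> i"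
    using x smult_l_distr[of a b x] by (simp add: quotient_ops scal_closed R)
  show "(a \<otimes>\<^bsub>ring_of_type_algebra\<^esub> b) \<odot>\<^bsub>quot_vlat\<^esub> i = a \<odot>\<^bsub>quot_vlat\<^esub> (b \<odot>\<^bsub>quot_vlat\<^esub> i)"
    using x smult_assoc1[of a b x] by (simp add: quotient_ops scal_closed R)
  show "\<one>\<^bsub>ring_of_type_algebra\<^esub> \<odot>\<^bsub>quot_vlat\<^esub> i = i"
    using x smult_one[of x] by (simp add: quotient_ops R)
  fix j assume "j \<in> carrier quot_vlat"
  then obtain y where y: "y \<in> carrier G" "j = rep y" by (auto simp: quotient_ops)
  show "a \<odot>\<^bsub>quot_vlat\<^esub> (i \<oplus>\<^bsub>quot_vlat\<^esub> j) = a \<odot>\<^bsub>quot_vlat\<^esub> i \<oplus>\<^bsub>quot_vlat\<^esub> a \<odot>\<^bsub>quot_vlat\<^esub> j"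
    using x y smult_r_distr[of a x y] by (simp add: quotient_ops scal_closed R)
qed

lemma quotient_vector_lattice: "vector_lattice quot_vlat"
proof (rule vector_lattice.intro[OF quotient_module], unfold_locales)
  fix i j k
  assume "i \<in> carrier quot_vlat" "j \<in> carrier quot_vlat" "k \<in> carrier quot_vlat"
    and le: "i \<preceq>\<^bsub>quot_vlat\<^esub> j"
  then obtain x y z where xyz: "x \<in> carrier G" "i = rep x" "y \<in> carrier G" "j = rep y"
    "z \<in> carrier G" "k = rep z" by (auto simp: quotient_ops)
  note ev = evaluates_var[OF xyz(1)] evaluates_var[OF xyz(3)] evaluates_var[OF xyz(5)]
  have "vdiff (x \<curlyvee> y) y \<in> K" using le xyz by (simp add: quotient_le_iff)
  \<comment> \<open>Translation by \<open>z\<close> leaves the positive part of \<open>x - y\<close>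
    unchanged.\<close>
  then have "vdiff ((x \<oplus> z) \<curlyvee> (y \<oplus> z)) (y \<oplus> z) \<in> K"
    by (rule K_dominated[OF evaluates_vdiff[OF evaluates_sup[OF evaluates_add[OF ev(1,3)]
            evaluates_add[OF ev(2,3)]] evaluates_add[OF ev(2,3)]]
          _ evaluates_vdiff[OF evaluates_sup[OF ev(1,2)] ev(2)]])
      (simp add: max_def)
  then show "i \<oplus>\<^bsub>quot_vlat\<^esub> k \<preceq>\<^bsub>quot_vlat\<^esub> j \<oplus>\<^bsub>quot_vlat\<^esub> k"
    using xyz by (simp add: quotient_ops quotient_le_iff)
next
  fix a :: real and i assume a: "0 \<le> a" and "i \<in> pos quot_vlat"
  then obtain x where x: "x \<in> pos G" "i = rep x" by (auto elim: quotient_posE)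
  then show "a \<odot>\<^bsub>quot_vlat\<^esub> i \<in> pos quot_vlat"
    using rep_pos[OF smult_pos[OF a x(1)]] by (simp add: quotient_ops pos_closed)
qed (auto simp: quotient_ops sup_closed inf_closed sup_assoc inf_assoc sup_absorb inf_absorb
    intro: arg_cong[OF sup_comm] arg_cong[OF inf_comm])

lemma quotient_trunc:
  assumes Q: "quotient_is_trunc"
  shows "trunc quot_vlat"
proof (rule trunc.intro[OF archimedean_vector_lattice.intro[OF quotient_vector_lattice]])
  have memI: "rep x = \<zero>\<^bsub>quot_vlat\<^esub>" if "x \<in> K" for x
  proof -
    have x: "x \<in> carrier G" using that K_subset by blast
    show ?thesis
      unfolding quotient_ops
      by (rule rep_eqI[OF evaluates_var[OF x] evaluates_zero that evaluates_var[OF x]]) simp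
  qed
  have memD: "x \<in> K" if x: "x \<in> carrier G" and "rep x = \<zero>\<^bsub>quot_vlat\<^esub>" for x
  proof -
    have "vdiff x \<zero> \<in> K" using that by (simp add: quotient_ops rep_eq_iff)
    then show ?thesis
      by (rule K_dominated[OF evaluates_var[OF x] _ evaluates_vdiff[OF evaluates_var[OF x] evaluates_zero]])
        simp
  qed
  show "archimedean_vector_lattice_axioms quot_vlat"
  proof
    fix i j assume i: "i \<in> pos quot_vlat" and j: "j \<in> carrier quot_vlat"
      and le: "\<And>n. 0 < n \<Longrightarrow> real n \<odot>\<^bsub>quot_vlat\<^esub> i \<preceq>\<^bsub>quot_vlat\<^esub> j"
    obtain x where x: "x \<in> pos G" "i = rep x" using i by (rule quotient_posE)
    obtain y where y: "y \<in> carrier G" "j = rep y" using j by (auto simp: quotient_ops)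
    \<comment> \<open>The bound \<open>y\<close> may fail to be positive, as
      \<open>quotient_is_trunc\<close> demands. Enlarging it to \<open>\<zero> \<curlyvee> y\<close>
      only shrinks the positive part of \<open>n * x - y\<close>, so membership in \<open>K\<close>
      survives.\<close>
    have pos: "\<zero> \<curlyvee> y \<in> pos G"
      by (rule posI_evaluates[OF evaluates_sup[OF evaluates_zero evaluates_var[OF y(1)]]]) simp
    have "x \<in> K"
    proof (rule quotient_archimedeanD[OF Q x(1) pos])
      fix n :: nat assume "0 < n"
      then have k: "vdiff (real n \<odot> x \<curlyvee> y) y \<in> K"
        using le[of n] x y by (simp add: quotient_ops quotient_le_iff pos_closed scal_closed)
      note ev = evaluates_smult[OF evaluates_var[OF pos_closed[OF x(1)]], of "real n"] evaluates_var[OF y(1)]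
        evaluates_sup[OF evaluates_zero evaluates_var[OF y(1)]]
      show "vdiff (real n \<odot> x \<curlyvee> (\<zero> \<curlyvee> y)) (\<zero> \<curlyvee> y) \<in> K"
        by (rule K_dominated[OF evaluates_vdiff[OF evaluates_sup[OF ev(1,3)] ev(3)] k
              evaluates_vdiff[OF evaluates_sup[OF ev(1,2)] ev(2)]])
          (auto simp: max_def)
    qed
    then show "i = \<zero>\<^bsub>quot_vlat\<^esub>" using memI x by simp
  qed
  show "trunc_axioms quot_vlat"
  proof (unfold_locales, goal_cases)
    case (1 i)
    then obtain x where "x \<in> pos G" "i = rep x" by (rule quotient_posE)
    then show ?case by (simp add: quotient_vtrunc rep_pos vtrunc_closed)
  next
    case (2 i j)
    obtain x where x: "x \<in> pos G" "i = rep x" using 2(1) by (rule quotient_posE)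
    obtain y where y: "y \<in> pos G" "j = rep y" using 2(2) by (rule quotient_posE)
    show ?case
      using x y inf_vtrunc_le[OF x(1) y(1)] pos_closed[OF vtrunc_closed[OF x(1)]]
        pos_closed[OF vtrunc_closed[OF y(1)]]
      by (simp add: quotient_vtrunc quotient_ops pos_closed quotient_mono inf_closed)
  next
    case (3 i)
    then obtain x where x: "x \<in> pos G" "i = rep x" by (rule quotient_posE)
    then show ?case
      using vtrunc_le[OF x(1)] pos_closed[OF vtrunc_closed[OF x(1)]]
      by (simp add: quotient_vtrunc quotient_mono pos_closed)
  next
    case (4 i)
    obtain x where x: "x \<in> pos G" "i = rep x" using 4(1) by (rule quotient_posE)
    have "vtrunc G x \<in> K"
      using 4(2) x memD[OF pos_closed[OF vtrunc_closed[OF x(1)]]] by (simp add: quotient_vtrunc)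
    then show ?case using quotient_vtruncD[OF Q x(1)] memI x(2) by simp
  next
    case (5 i)
    obtain x where x: "x \<in> pos G" "i = rep x" using 5(1) by (rule quotient_posE)
    have "x \<in> K"
    proof (rule quotient_multiplesD[OF Q x(1)])
      fix n :: nat assume "0 < n"
      from 5(2)[OF this] x show "vdiff (real n \<odot> x) (vtrunc G (real n \<odot> x)) \<in> K"
        using scal_pos[OF x(1), of n] pos_closed[OF vtrunc_closed[OF scal_pos[OF x(1)]]]
        by (simp add: quotient_ops quotient_vtrunc rep_eq_iff pos_closed)
    qed
    then show ?case using memI x(2) by simp
  qed
qed

lemma kernel_of_quotient_is_trunc:
  assumes Q: "quotient_is_trunc"
  shows "truncation_kernel G K"
  unfolding truncation_kernel_def
proof (intro exI conjI)
  show "trunc quot_vlat" using Q by (rule quotient_trunc)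
  show "rep \<in> trunc_hom G quot_vlat"
    by (simp add: trunc_hom_def quotient_ops quotient_vtrunc)
  show "K = {g \<in> carrier G. rep g = \<zero>\<^bsub>quot_vlat\<^esub>}"
  proof (rule equalityI; rule subsetI)
    fix g assume g: "g \<in> K"
    then have gc: "g \<in> carrier G" using K_subset by blast
    with g show "g \<in> {g \<in> carrier G. rep g = \<zero>\<^bsub>quot_vlat\<^esub>}"
      using K_vdiff[OF g K_zero] by (simp add: quotient_ops rep_eq_iff)
  next
    fix g assume "g \<in> {g \<in> carrier G. rep g = \<zero>\<^bsub>quot_vlat\<^esub>}"
    then have g: "g \<in> carrier G" and "rep g = rep \<zero>" by (simp_all add: quotient_ops)
    then have k: "vdiff g \<zero> \<in> K" by (simp add: rep_eq_iff)
    show "g \<in> K"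
      by (rule K_dominated[OF evaluates_var[OF g] k evaluates_vdiff[OF evaluates_var[OF g] evaluates_zero]])
        simp
  qed
qed

subsection \<open>The cozero element of a convex subtrunc\<close>

text \<open>Since \<open>K\<close> is closed under scaling, the threshold \<open>1\<close> stands
  for every positive threshold. Fixing it leaves a single element of \<open>M\<close> for each
  \<open>k\<close>, which suits the extraction of finite subcovers.\<close>

definition cozero :: 'm where
  "cozero = (SUP k\<in>K \<inter> pos G. ext k (Opens {1<..}))"

lemma q_frame_hom: "frame_hom q"
  using q_hom by (simp add: pointed_frame_hom_def)

lemma ext_frame_hom: "x \<in> carrier G \<Longrightarrow> frame_hom (ext x)"
  using ext_hom by (simp add: pointed_frame_hom_def)

lemma pM_ext: "x \<in> carrier G \<Longrightarrow> open U \<Longrightarrow> pM (ext x (Opens U)) \<longleftrightarrow> 0 \<in> U"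
  using ext_hom[of x] by (simp add: pointed_frame_hom_def opens_point_def fun_eq_iff)

lemma q_ext:
  assumes "x \<in> carrier G" "open U"
  shows "q (ext x (Opens U)) = \<rho> x (Opens (ereal -` U))"
proof -
  have "open (ereal -` U)" using assms(2) by (rule open_vimage) (intro continuous_intros)
  then have "restrict_real (Opens U) = Opens (ereal -` U)" using assms(2) by (simp add: opens_eq_iff)
  then show ?thesis using fun_cong[OF ext_commutes[OF assms(1)], of "Opens U"] by simp
qed

lemma covered_q_ext:
  assumes x: "evaluates x w" and "open U"
  shows "covered (q (ext x (Opens U))) (\<lambda>\<phi>. ereal (w \<phi>) \<in> U)"
proof -
  have "open (ereal -` U)" using assms(2) by (rule open_vimage) (intro continuous_intros)
  then show ?thesis
    using evaluates_covered[OF x, of "ereal -` U"] q_ext[OF evaluates_closed[OF x] assms(2)] by simp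
qed

text \<open>Density of \<open>q\<close> reduces disjointness in \<open>M\<close> to disjointness in \<open>L\<close>, and hence an inequality
  in \<open>M\<close> to a disjointness at the pseudo-points.\<close>

lemma le_ext_of_covered:
  assumes a: "covered (q a) A" and x: "evaluates x w" and U: "open U" and W: "open W"
    and UW: "U \<union> W = UNIV" and disj: "\<And>\<phi>. A \<phi> \<Longrightarrow> ereal (w \<phi>) \<notin> W"
  shows "a \<le> ext x (Opens U)"
proof (rule frame_le_of_disjoint)
  have "covered (inf (q a) (q (ext x (Opens W)))) (\<lambda>\<phi>. A \<phi> \<and> ereal (w \<phi>) \<in> W)"
    by (intro covered_inf a covered_q_ext x W)
  then have "covered (q (inf a (ext x (Opens W)))) (\<lambda>_. False)"
    unfolding frame_hom_inf[OF q_frame_hom] by (rule covered_mono) (use disj in auto)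
  then have "q (inf a (ext x (Opens W))) = bot" by (rule covered_False)
  then show "inf a (ext x (Opens W)) = bot" using q_dense unfolding dense_hom_def by blast
  have hx: "frame_hom (ext x)" by (rule ext_frame_hom[OF evaluates_closed[OF x]])
  have "sup (Opens W) (Opens U) = top" using UW U W by (auto simp: opens_eq_iff)
  then show "sup (ext x (Opens W)) (ext x (Opens U)) = top"
    using frame_hom_sup[OF hx] frame_hom_top[OF hx] by metis
qed

lemma ext_le_cozero:
  assumes k: "k \<in> K" "k \<in> pos G" and r: "0 < r"
  shows "ext k (Opens {ereal r<..}) \<le> cozero"
proof -
  \<comment> \<open>The factor moves values above \<open>r\<close> to values above \<open>2\<close>,
    and the gap between \<open>1\<close> and \<open>2\<close> lets two open rays cover the extended
    line.\<close>
  let ?k = "(2 / r) \<odot> k"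
  have "ext k (Opens {ereal r<..}) \<le> ext ?k (Opens {1<..})"
  proof (rule le_ext_of_covered[OF covered_q_ext[OF evaluates_pos[OF k(2)]]
        evaluates_smult[OF evaluates_pos[OF k(2)]]])
    show "{1<..} \<union> {..<ereal 2} = UNIV" by (auto simp: not_less intro: le_less_trans[of _ 1])
    fix \<phi> :: "'g \<Rightarrow> real" assume "ereal (max 0 (\<phi> k)) \<in> {ereal r<..}"
    then have "r < max 0 (\<phi> k)" by (simp only: greaterThan_iff less_ereal.simps(1))
    then have "2 \<le> 2 / r * max 0 (\<phi> k)" using r by (simp add: field_simps)
    then show "ereal (2 / r * max 0 (\<phi> k)) \<notin> {..<ereal 2}"
      by (simp only: lessThan_iff less_ereal.simps(1) not_less)
  qed auto
  also have "\<dots> \<le> cozero"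
    unfolding cozero_def using k r by (intro SUP_upper) (simp add: K_smult smult_pos)
  finally show ?thesis .
qed

section \<open>Compactness and membership in \<open>K\<close>\<close>

lemma finite_bound:
  assumes "finite C" "C \<subseteq> K \<inter> pos G"
  shows "\<exists>k\<in>K \<inter> pos G. \<forall>c\<in>C. \<rho> c (Opens {r<..}) \<le> \<rho> k (Opens {r<..})"
  using assms
proof (induction C)
  case empty
  have "\<zero> \<in> pos G" by (rule posI_evaluates[OF evaluates_zero]) simp
  with K_zero show ?case by auto
next
  case (insert c C)
  then obtain k where k: "k \<in> K" "k \<in> pos G" "\<forall>c\<in>C. \<rho> c (Opens {r<..}) \<le> \<rho> k (Opens {r<..})"
    by auto
  have c: "c \<in> K" "c \<in> pos G" using insert.prems by auto
  note ev = evaluates_pos[OF k(2)] evaluates_pos[OF c(2)]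
  have "k \<curlyvee> c \<in> pos G" by (rule posI_evaluates[OF evaluates_sup[OF ev]]) simp
  moreover have "k \<preceq> k \<curlyvee> c" "c \<preceq> k \<curlyvee> c"
    by (rule le_of_evaluates[OF ev(1) evaluates_sup[OF ev]], simp)
      (rule le_of_evaluates[OF ev(2) evaluates_sup[OF ev]], simp)
  ultimately have "\<rho> k (Opens {r<..}) \<le> \<rho> (k \<curlyvee> c) (Opens {r<..})"
      "\<rho> c (Opens {r<..}) \<le> \<rho> (k \<curlyvee> c) (Opens {r<..})"
    using k c by (simp_all add: rho_upper_mono pos_closed)
  then show ?case
    using k c \<open>k \<curlyvee> c \<in> pos G\<close> K_sup[OF k(1) c(1)] by (intro bexI[of _ "k \<curlyvee> c"]) (auto intro: order_trans)
qed

text \<open>The rays below \<open>r\<close> and above \<open>r / 2\<close> cover the extended line,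
  and \<open>ext f\<close> maps the second below \<open>cozero\<close>. So the image of the first
  and the generators of \<open>cozero\<close> cover \<open>M\<close>. Compactness leaves finitely
  many generators, their images in \<open>L\<close> are bounded by that of one \<open>k\<close>, and
  \<open>q\<close> carries the cover to \<open>L\<close>.\<close>

lemma cozero_compact:
  assumes f: "f \<in> pos G" and r: "0 < r" and le: "\<And>r. 0 < r \<Longrightarrow> ext f (Opens {ereal r<..}) \<le> cozero"
  shows "\<exists>k\<in>K \<inter> pos G. sup (\<rho> k (Opens {1<..})) (\<rho> f (Opens {..<r})) = top"
proof -
  have hf: "frame_hom (ext f)" by (rule ext_frame_hom[OF pos_closed[OF f]])
  let ?e = "ext f (Opens {..<ereal r})" and ?E = "\<lambda>k. ext k (Opens {1<..})"
  have "sup (Opens {..<ereal r}) (Opens {ereal (r / 2)<..}) = top"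
    using r by (auto simp: opens_eq_iff not_less intro: less_le_trans[of "ereal (r / 2)" "ereal r"])
  then have "sup ?e (ext f (Opens {ereal (r / 2)<..})) = top"
    using frame_hom_sup[OF hf] frame_hom_top[OF hf] by metis
  then have "sup ?e cozero = top" using le[of "r / 2"] r by (metis half_gt_zero sup_mono order_refl top_unique)
  then have "Sup (insert ?e (?E ` (K \<inter> pos G))) = top" by (simp add: cozero_def)
  then obtain F where F: "F \<subseteq> insert ?e (?E ` (K \<inter> pos G))" "finite F" "Sup F = top"
    using compact_M unfolding compact_frame_def by blast
  have "F - {?e} \<subseteq> ?E ` (K \<inter> pos G)" using F(1) by blast
  with F(2) obtain C where C: "C \<subseteq> K \<inter> pos G" "finite C" "F - {?e} = ?E ` C"
    by (meson finite_Diff finite_subset_image)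
  obtain k where k: "k \<in> K \<inter> pos G" "\<forall>c\<in>C. \<rho> c (Opens {1<..}) \<le> \<rho> k (Opens {1<..})"
    using finite_bound[OF C(2,1)] by blast
  have q1: "q (?E c) = \<rho> c (Opens {1<..})" if "c \<in> pos G" for c
  proof -
    have "ereal -` {1<..} = {1<..}" by (auto simp: one_ereal_def)
    then show ?thesis using that by (simp add: q_ext pos_closed)
  qed
  have "ereal -` {..<ereal r} = {..<r}" by auto
  then have qe: "q ?e = \<rho> f (Opens {..<r})" using f by (simp add: q_ext pos_closed)
  have "top = q (Sup F)" using F(3) frame_hom_top[OF q_frame_hom] by simp
  also have "\<dots> = Sup (q ` F)" by (rule frame_hom_Sup[OF q_frame_hom])
  also have "\<dots> \<le> sup (\<rho> k (Opens {1<..})) (\<rho> f (Opens {..<r}))"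
  proof (rule SUP_least)
    fix s assume s: "s \<in> F"
    show "q s \<le> sup (\<rho> k (Opens {1<..})) (\<rho> f (Opens {..<r}))"
    proof (cases "s = ?e")
      case True
      then show ?thesis by (simp add: qe)
    next
      case False
      then obtain c where "c \<in> C" "s = ?E c" using C(3) s by blast
      moreover from this have "c \<in> pos G" using C(1) by blast
      ultimately show ?thesis using k(2) q1 by (metis sup.coboundedI1)
    qed
  qed
  finally show ?thesis using k(1) by (meson top_unique)
qed

text \<open>It suffices to treat the truncation of \<open>f\<close>, whose values are at most
  \<open>1\<close>. On the cover from \<open>cozero_compact\<close> with \<open>r = 1 / n\<close>,
  the positive part of \<open>n * min f 1 - 1\<close> vanishes where \<open>f < 1 / n\<close>, and
  is at most \<open>n\<close>, hence at most \<open>n * k\<close>, where \<open>k > 1\<close>. So it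
  lies in \<open>K\<close> for each \<open>n\<close>, and the axiom on multiples applies modulo
  \<open>K\<close>.\<close>

lemma mem_of_le_cozero:
  assumes Q: "quotient_is_trunc" and f: "f \<in> pos G"
    and le: "\<And>r. 0 < r \<Longrightarrow> ext f (Opens {ereal r<..}) \<le> cozero"
  shows "f \<in> K"
proof (rule quotient_vtruncD[OF Q f], rule quotient_multiplesD[OF Q vtrunc_closed[OF f]])
  fix n :: nat assume n: "0 < n"
  obtain k where k: "k \<in> K" "k \<in> pos G"
    and top: "sup (\<rho> k (Opens {1<..})) (\<rho> f (Opens {..<1 / real n})) = top"
    using cozero_compact[OF f _ le, of "1 / real n"] n by auto
  have "covered (sup (\<rho> k (Opens {1<..})) (\<rho> f (Opens {..<1 / real n})))
      (\<lambda>\<phi>. max 0 (\<phi> k) \<in> {1<..} \<or> max 0 (\<phi> f) \<in> {..<1 / real n})"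
    by (intro covered_sup evaluates_covered evaluates_pos k f) auto
  then have A: "covered top (\<lambda>\<phi>. max 0 (\<phi> k) \<in> {1<..} \<or> max 0 (\<phi> f) \<in> {..<1 / real n})"
    unfolding top .
  let ?h = "real n \<odot> vtrunc G f"
  have ev: "evaluates (vdiff ?h (vtrunc G ?h))
      (\<lambda>\<phi>. real n * min (max 0 (\<phi> f)) 1 - min (real n * min (max 0 (\<phi> f)) 1) 1)"
    by (intro evaluates_intros evaluates_vdiff evaluates_pos f scal_pos vtrunc_closed)
  show "vdiff ?h (vtrunc G ?h) \<in> K"
  proof (rule K_dominated2[OF ev K_smult[OF k(1)] evaluates_smult[OF evaluates_pos[OF k(2)], of "real n"]
        K_zero evaluates_zero A])
    fix \<phi> assume *: "max 0 (\<phi> k) \<in> {1<..} \<or> max 0 (\<phi> f) \<in> {..<1 / real n}"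
    define s t where "s = max 0 (\<phi> f)" and "t = max 0 (\<phi> k)"
    have nn: "0 \<le> s" "0 \<le> t" by (simp_all add: s_def t_def)
    have "real n * min s 1 - min (real n * min s 1) 1 \<le> real n * t"
    proof (cases "1 < t")
      case True
      then have "real n * min s 1 \<le> real n * t" by (intro mult_left_mono) auto
      moreover have "0 \<le> min (real n * min s 1) 1" using nn by simp
      ultimately show ?thesis by linarith
    next
      case False
      then have "s < 1 / real n" using * by (simp add: s_def t_def)
      then have "real n * s < 1" using n by (simp add: field_simps)
      moreover have "real n * min s 1 \<le> real n * s" by (intro mult_left_mono) auto
      ultimately have "real n * min s 1 - min (real n * min s 1) 1 = 0" by simp
      then show ?thesis using nn by simp
    qed
    moreover have "0 \<le> real n * min s 1 - min (real n * min s 1) 1" by simp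
    ultimately show "\<bar>real n * min (max 0 (\<phi> f)) 1 - min (real n * min (max 0 (\<phi> f)) 1) 1\<bar>
        \<le> \<bar>real n * max 0 (\<phi> k)\<bar> + \<bar>0\<bar>"
      by (simp add: s_def t_def)
  qed
qed

section \<open>The cozero element belongs to the sublocale given by \<open>q\<close>\<close>

text \<open>The key step: \<open>f - \<bar>h\<bar> / n\<close> is positive only where \<open>f\<close> is positive and \<open>h\<close> is finite, so
  relatively uniform closedness of \<open>K\<close> lets the open set where \<open>h\<close> is finite be ignored.\<close>

lemma ext_inf_finite_le_cozeroD:
  assumes Q: "quotient_is_trunc" and g: "g \<in> pos G" and h: "h \<in> carrier G"
    and le: "inf (ext (vtrunc G g) (Opens {0<..})) (ext h (Opens {-\<infinity><..<\<infinity>})) \<le> cozero"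
  shows "ext (vtrunc G g) (Opens {0<..}) \<le> cozero"
proof -
  let ?f = "vtrunc G g" and ?y = "h \<curlyvee> (-1) \<odot> h"
  have f: "?f \<in> pos G" using g by (rule vtrunc_closed)
  have evf: "evaluates ?f (\<lambda>\<phi>. min (max 0 (\<phi> g)) 1)" by (intro evaluates_vtrunc evaluates_pos g)
  have evh: "evaluates h (\<lambda>\<phi>. \<phi> h)" using h by (rule evaluates_var)
  have evy: "evaluates ?y (\<lambda>\<phi>. max (\<phi> h) (-1 * \<phi> h))" by (intro evaluates_intros evh)
  have y: "?y \<in> pos G" by (rule posI_evaluates[OF evy]) simp
  have "?f \<in> K"
  proof (rule quotient_archimedeanD[OF Q f y], rule mem_of_le_cozero[OF Q])
    fix n :: nat assume n: "0 < n"
    let ?e = "vdiff (real n \<odot> ?f \<curlyvee> ?y) ?y"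
    have eve: "evaluates ?e (\<lambda>\<phi>. max (real n * min (max 0 (\<phi> g)) 1) (max (\<phi> h) (-1 * \<phi> h)) - max (\<phi> h) (-1 * \<phi> h))"
      by (intro evaluates_vdiff evaluates_intros evf evy evh evaluates_pos g)
    show "?e \<in> pos G" by (rule posI_evaluates[OF eve]) simp
    fix r :: real assume r: "0 < r"
    define e where "e = ext ?e (Opens {ereal r<..})"
    have cov: "covered (q e) (\<lambda>\<phi>. ereal (max (real n * min (max 0 (\<phi> g)) 1) (max (\<phi> h) (-1 * \<phi> h))
        - max (\<phi> h) (-1 * \<phi> h)) \<in> {ereal r<..})"
      unfolding e_def by (intro covered_q_ext eve) simp
    \<comment> \<open>Where the value of \<open>?e\<close> exceeds \<open>r\<close>, also
      \<open>n * ?f\<close> exceeds \<open>r\<close>, so \<open>?f\<close> avoids the open ray below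
      \<open>r / n\<close>.\<close>
    have "e \<le> ext ?f (Opens {0<..})"
    proof (rule le_ext_of_covered[OF cov evf])
      show "{0<..} \<union> {..<ereal (r / n)} = UNIV"
        using r n by (auto simp: not_less intro: less_le_trans[of 0 "ereal (r / n)"])
      fix \<phi> assume "ereal (max (real n * min (max 0 (\<phi> g)) 1) (max (\<phi> h) (-1 * \<phi> h))
        - max (\<phi> h) (-1 * \<phi> h)) \<in> {ereal r<..}"
      then have "r < real n * min (max 0 (\<phi> g)) 1" using r by (auto simp: max_def split: if_splits)
      then have "r / n < min (max 0 (\<phi> g)) 1" using n by (simp only: pos_divide_less_eq of_nat_0_less_iff mult.commute)
      then show "ereal (min (max 0 (\<phi> g)) 1) \<notin> {..<ereal (r / n)}"
        by (simp only: lessThan_iff less_ereal.simps(1) not_less less_imp_le)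
    qed simp_all
    \<comment> \<open>Truncation bounds \<open>n * ?f\<close> by \<open>n\<close>, so
      \<open>?e\<close> can be positive only where the absolute value of \<open>h\<close> is below
      \<open>n\<close>. The two open rays beyond \<open>-n\<close> and \<open>n\<close> contain both
      infinities and complete the cover of the extended line.\<close>
    moreover have "e \<le> ext h (Opens {-\<infinity><..<\<infinity>})"
    proof (rule le_ext_of_covered[OF cov evh])
      show "{-\<infinity><..<\<infinity>} \<union> ({..<ereal (- real n)} \<union> {ereal (real n)<..}) = UNIV"
      proof -
        have "x \<in> {-\<infinity><..<\<infinity>} \<union> ({..<ereal (- real n)} \<union> {ereal (real n)<..})" for x :: ereal
          by (cases x) auto
        then show ?thesis by blast
      qed
      fix \<phi> assume "ereal (max (real n * min (max 0 (\<phi> g)) 1) (max (\<phi> h) (-1 * \<phi> h))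
        - max (\<phi> h) (-1 * \<phi> h)) \<in> {ereal r<..}"
      moreover have "real n * min (max 0 (\<phi> g)) 1 \<le> real n * 1" by (intro mult_left_mono) auto
      ultimately have "max (\<phi> h) (-1 * \<phi> h) < real n" using r by (auto simp: max_def split: if_splits)
      then show "ereal (\<phi> h) \<notin> {..<ereal (- real n)} \<union> {ereal (real n)<..}" by auto
    qed auto
    ultimately show "ext ?e (Opens {ereal r<..}) \<le> cozero"
      using le unfolding e_def by (meson le_infI order_trans)
  qed
  have "Opens {0<..} = (SUP r\<in>{0<..}. Opens {ereal r<..})"
  proof -
    have "\<exists>r>0. ereal r < x" if "0 < x" for x :: ereal
      using ereal_dense2[OF that] by (metis ereal_less(2))
    then show ?thesis by (auto simp: opens_eq_iff intro: less_trans[of 0 "ereal _"])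
  qed
  then have "ext ?f (Opens {0<..}) = (SUP r\<in>{0<..}. ext ?f (Opens {ereal r<..}))"
    using frame_hom_Sup[OF ext_frame_hom[OF pos_closed[OF f]]] by (simp add: image_image)
  also have "\<dots> \<le> cozero" using ext_le_cozero[OF \<open>?f \<in> K\<close> f] by (intro SUP_least) simp
  finally show ?thesis .
qed

lemma pM_cozero: "\<not> pM cozero"
proof -
  have "pM cozero \<longleftrightarrow> (\<exists>k\<in>K \<inter> pos G. pM (ext k (Opens {1<..})))"
    unfolding cozero_def frame_hom_Sup[OF point_M] by auto
  then show ?thesis by (auto simp: pM_ext pos_closed)
qed

text \<open>It suffices that \<open>inf c ?a \<le> cozero\<close> implies
  \<open>c \<le> cozero\<close>, for then \<open>heyting_imp ?a cozero = cozero\<close>. By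
  \<open>joins_M\<close> this need only be checked on generators below \<open>c\<close>. Those from
  \<open>(0, \<infinity>]\<close> are handled by \<open>ext_inf_finite_le_cozeroD\<close>. Those
  from \<open>[-\<infinity>, 1)\<close> cannot occur: they contain the base point, as does
  \<open>?a\<close>, but \<open>cozero\<close> does not.\<close>

lemma cozero_mem_open_sublocale:
  assumes Q: "quotient_is_trunc" and h: "h \<in> carrier G"
  shows "cozero \<in> open_sublocale (ext h (Opens {-\<infinity><..<\<infinity>}))"
proof -
  let ?a = "ext h (Opens {-\<infinity><..<\<infinity>})"
  have "c \<le> cozero" if c: "inf c ?a \<le> cozero" for c
  proof -
    obtain S where S: "S \<subseteq> (\<lambda>g. ext g (Opens {0<..})) ` vtrunc G ` pos G
        \<union> (\<lambda>g. ext g (Opens {..<1})) ` vtrunc G ` pos G" and cS: "c = Sup S"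
      using joins_M[of c] by blast
    have "s \<le> cozero" if s: "s \<in> S" for s
    proof -
      have "s \<le> c" using s cS by (simp add: Sup_upper)
      then have sa: "inf s ?a \<le> cozero" using c by (meson inf_mono order_refl order_trans)
      consider g where "g \<in> pos G" "s = ext (vtrunc G g) (Opens {0<..})"
        | g where "g \<in> pos G" "s = ext (vtrunc G g) (Opens {..<1})"
        using S s by blast
      then show ?thesis
      proof cases
        case 1
        then show ?thesis using ext_inf_finite_le_cozeroD[OF Q 1(1) h] sa by simp
      next
        case 2
        have "pM s" "pM ?a"
          using 2 h pos_closed[OF vtrunc_closed[OF 2(1)]] by (simp_all add: pM_ext)
        then have "pM (inf s ?a)" by (simp add: frame_hom_inf[OF point_M])
        then show ?thesis using frame_hom_mono[OF point_M sa] pM_cozero by simp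
      qed
    qed
    then show ?thesis unfolding cS by (rule Sup_least)
  qed
  then have "heyting_imp ?a cozero = cozero"
    unfolding heyting_imp_def by (intro antisym Sup_least Sup_upper) auto
  then show ?thesis unfolding open_sublocale_def by (metis rangeI)
qed

text \<open>Lying in all the open sublocales, \<open>cozero\<close> has the form
  \<open>right_adjoint q y\<close> by \<open>image_L\<close>, and the adjunction moves the
  inequality from \<open>L\<close> back to \<open>M\<close>.\<close>

lemma le_cozero_of_q_le:
  assumes Q: "quotient_is_trunc" and c: "q c \<le> q cozero"
  shows "c \<le> cozero"
proof -
  have "cozero \<in> range (right_adjoint q)"
    unfolding image_L using cozero_mem_open_sublocale[OF Q] by blast
  then obtain y where y: "cozero = right_adjoint q y" by blast
  have "q cozero \<le> y"
    unfolding y right_adjoint_def frame_hom_Sup[OF q_frame_hom] by (auto intro: SUP_least)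
  with c have "q c \<le> y" by (rule order_trans)
  then show ?thesis unfolding y right_adjoint_def by (intro Sup_upper) simp
qed

section \<open>Pointwise suprema of subsets of \<open>K\<close>\<close>

lemma pointwise_sup_pos:
  assumes K0: "K0 \<subseteq> pos G" and g: "g \<in> carrier G" and sup: "pointwise_sup \<rho> K0 g"
  shows "g \<in> pos G"
proof -
  \<comment> \<open>The base point rules out an empty \<open>K0\<close>: a ray containing
    \<open>0\<close> has nonzero image under \<open>\<rho> g\<close>, whereas the empty join is
    \<open>bot\<close>.\<close>
  have "pL (\<rho> g (Opens {-1<..}))"
    using rho_pointed[OF g] by (simp add: pointed_frame_hom_def opens_point_def fun_eq_iff)
  then have "\<rho> g (Opens {-1<..}) \<noteq> bot" using frame_hom_bot[OF point_L] by auto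
  then obtain k where k: "k \<in> K0"
    using sup unfolding pointwise_sup_def by (metis SUP_empty all_not_in_conv)
  have kp: "k \<in> pos G" using k K0 by blast
  have "\<zero> \<preceq> g"
  proof (rule le_of_evaluates_close[OF evaluates_zero evaluates_var[OF g]])
    fix e :: real assume "0 < e"
    have "top \<le> \<rho> k (Opens {- e<..})"
      by (rule le_rho_of_covered[OF covered_top evaluates_pos[OF kp], of _ 0]) (use \<open>0 < e\<close> in simp_all)
    also have "\<dots> \<le> \<rho> g (Opens {- e<..})"
      using sup k unfolding pointwise_sup_def by (metis SUP_upper)
    finally have "\<rho> g (Opens {- e<..}) = top" by (rule top_le)
    then have "covered top (\<lambda>\<phi>. \<phi> g \<in> {- e<..})"
      using evaluates_covered[OF evaluates_var[OF g], of "{- e<..}"] by simp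
    then show "\<exists>A. covered top A \<and> (\<forall>\<phi>. A \<phi> \<longrightarrow> 0 \<le> \<phi> g + e)"
      by (intro exI[of _ "\<lambda>\<phi>. \<phi> g \<in> {- e<..}"]) auto
  qed
  with g show ?thesis by (simp add: pos_def)
qed

text \<open>In \<open>L\<close> the element for \<open>g\<close> above \<open>r\<close> is the join
  of those for members of \<open>K0\<close>, each below \<open>q cozero\<close>. The resulting
  inequality lifts to \<open>M\<close> by \<open>le_cozero_of_q_le\<close>, where compactness puts
  \<open>g\<close> into \<open>K\<close>.\<close>

lemma pointwise_closed_of_quotient_is_trunc:
  assumes Q: "quotient_is_trunc"
  shows "pointwise_closed G \<rho> K"
  unfolding pointwise_closed_def
proof (intro allI impI ballI)
  fix K0 g assume K0: "K0 \<subseteq> K \<inter> pos G" and g: "g \<in> carrier G" and sup: "pointwise_sup \<rho> K0 g"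
  have gp: "g \<in> pos G" using K0 by (intro pointwise_sup_pos[OF _ g sup]) blast
  have vim: "ereal -` {ereal r<..} = {r<..}" for r by auto
  show "g \<in> K"
  proof (rule mem_of_le_cozero[OF Q gp], rule le_cozero_of_q_le[OF Q])
    fix r :: real assume r: "0 < r"
    have "q (ext g (Opens {ereal r<..})) = (SUP k\<in>K0. \<rho> k (Opens {r<..}))"
      using sup g by (simp add: q_ext vim pointwise_sup_def)
    also have "\<dots> \<le> q cozero"
    proof (rule SUP_least)
      fix k assume "k \<in> K0"
      then have k: "k \<in> K" "k \<in> pos G" using K0 by auto
      have "\<rho> k (Opens {r<..}) = q (ext k (Opens {ereal r<..}))"
        using k by (simp add: q_ext vim pos_closed)
      also have "\<dots> \<le> q cozero" by (rule frame_hom_mono[OF q_frame_hom ext_le_cozero[OF k r]])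
      finally show "\<rho> k (Opens {r<..}) \<le> q cozero" .
    qed
    finally show "q (ext g (Opens {ereal r<..})) \<le> q cozero" .
  qed
qed

end

theorem proposition9p2p1:
  fixes G :: "'g vlat" and K :: "'g set"
    and pL :: "'l::frame \<Rightarrow> bool" and pM :: "'m::frame \<Rightarrow> bool"
    and q :: "'m \<Rightarrow> 'l" and \<rho> :: "'g \<Rightarrow> real opens \<Rightarrow> 'l" and ext :: "'g \<Rightarrow> ereal opens \<Rightarrow> 'm"
  assumes "trunc G"
    and "madden_representation G pL pM q \<rho> ext"
    and "convex_subtrunc G K"
  shows "truncation_kernel G K \<longleftrightarrow> pointwise_closed G \<rho> K"
proof -
  interpret convex_madden_representation G pL pM q \<rho> ext K
    using assms(2,3) by (intro convex_madden_representation.intro convex_madden_representation_axioms.intro)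
  show ?thesis
    using quotient_is_trunc_of_kernel kernel_of_quotient_is_trunc quotient_is_trunc_of_closed
      pointwise_closed_of_quotient_is_trunc by blast
qed

end
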